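(* Let $d\ge1$ and let $G=(V,E)$ be a graph. If $G$ is $d$-connected and chordal, then $G$ has a globally rigid gluing construction in $\mathbb{R}^d$. Consequently, $G$ is $d$-joined.
   Context: A graph is chordal if it has no induced cycle of length at least four. $G$ is $d$-connected if it has at least $d+1$ vertices and no vertex set of size at most $d-1$ whose removal disconnects it. A $d$-dimensional realization of $G$ is a pair $(G,p)$ with $p:V\to\mathbb{R}^d$; it is generic if the $d|V|$ coordinates of $p$ are algebraically independent over $\mathbb{Q}$. $(G,p),(G,q)$ are equivalent if $\|p(x)-p(y)\|=\|q(x)-q(y)\|$ for all edges $xy$, congruent if this holds for all pairs of vertices. $G$ is rigid in $\mathbb{R}^d$ if for a generic realization $(G,p)$ there is $\varepsilon>0$ such that every equivalent $(G,q)$ with $\|p(x)-q(x)\|<\varepsilon$ for all $x$ is congruent to $(G,p)$; $G$ is globally rigid in $\mathbb{R}^d$ if for every generic realization every equivalent realization in $\mathbb{R}^d$ is congruent to it. A pair $\{x,y\}$ is globally linked in $G$ in $\mathbb{R}^d$ if for every generic realization $(G,p)$ and every equivalent realization $(G,q)$ in $\mathbb{R}^d$, $\|p(x)-p(y)\|=\|q(x)-q(y)\|$. $\kappa(G,x,y)$ is the maximum number of internally vertex-disjoint $x$–$y$ paths. $G$ is $d$-joined if $|V|\ge d+1$, $G$ is rigid in $\mathbb{R}^d$, and for all $x,y\in V$: $\{x,y\}$ is globally linked iff $xy\in E$ or $\kappa(G,x,y)\ge d+1$. For a graph $G$ on at least $d+1$ vertices, a globally rigid gluing construction in $\mathbb{R}^d$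 of $G$ is a sequence of graphs $G_1,\dots,G_k=G$ such that for every $i$, either $G_i$ is a graph on at least $d+1$ vertices that is globally rigid in $\mathbb{R}^d$, or there are indices $1\le j<l<i$ such that $G_i$ is the union of $G_j$ and $G_l$ with $V(G_j)\ne V(G_i)\ne V(G_l)$ and $|V(G_j)\cap V(G_l)|\ge d$. *)

theory Defs
  imports
    "HOL-Analysis.Analysis"
    "HOL-Library.Poly_Mapping"
    "Graph_Theory.Graph_Theory"
begin

text \<open>
  A finite simple graph is a \<^locale>\<open>pair_graph\<close>: a finite, symmetric, loopfree digraph whose
  arcs are pairs of vertices, so an undirected edge \<open>uv\<close> is the pair of arcs \<open>(u, v)\<close>, \<open>(v, u)\<close>.
  The dimension \<open>d\<close> is the cardinality of the finite index type \<open>'d\<close>, which is passed as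
  \<open>TYPE('d)\<close> to notions that quantify over realizations.
\<close>

section \<open>Graphs\<close>

text \<open>
  The library regards \<open>a, b, a\<close> as a cycle of a symmetric digraph, but not one of length at
  least four. A cycle is induced if its own edges are all the edges among its vertices.
\<close>

definition chordal :: "'a pair_pre_digraph \<Rightarrow> bool" where
  "chordal G \<longleftrightarrow>
    \<not> (\<exists>C. pre_digraph.cycle (with_proj G) C \<and> length C \<ge> 4 \<and>
          arcs (with_proj G \<restriction> (fst ` set C)) = set C \<union> (set C)\<inverse>)"

definition vertex_connected :: "nat \<Rightarrow> 'a pair_pre_digraph \<Rightarrow> bool" where
  "vertex_connected d G \<longleftrightarrow>
    card (pverts G) \<ge> d + 1 \<and>
    (\<forall>S \<subseteq> pverts G. card S < d \<longrightarrow>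
       Digraph_Component.connected (with_proj G \<restriction> (pverts G - S)))"

definition paths_between :: "'a pair_pre_digraph \<Rightarrow> 'a \<Rightarrow> 'a \<Rightarrow> 'a vwalk set" where
  "paths_between G x y = {p. vpath p (with_proj G) \<and> hd p = x \<and> last p = y}"

text \<open>Only used for \<open>x \<noteq> y\<close>. The one-edge path \<open>[x, y]\<close> counts if \<open>x\<close> and \<open>y\<close> are adjacent.\<close>

definition local_connectivity :: "'a pair_pre_digraph \<Rightarrow> 'a \<Rightarrow> 'a \<Rightarrow> nat" where
  "local_connectivity G x y =
    Max {card P | P. P \<subseteq> paths_between G x y \<and>
                     pairwise (\<lambda>p q. set p \<inter> set q = {x, y}) P}"

section \<open>Generic realizations\<close>

text \<open>Rational polynomials in variables indexed by \<open>'i\<close> are finitely supported maps from monomials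
  (finitely supported exponent maps) to coefficients.\<close>

definition poly_value :: "(('i \<Rightarrow>\<^sub>0 nat) \<Rightarrow>\<^sub>0 rat) \<Rightarrow> ('i \<Rightarrow> real) \<Rightarrow> real" where
  "poly_value P x =
    (\<Sum>m\<in>Poly_Mapping.keys P. of_rat (Poly_Mapping.lookup P m) *
       (\<Prod>i\<in>Poly_Mapping.keys m. x i ^ Poly_Mapping.lookup m i))"

definition algebraically_independent :: "'i set \<Rightarrow> ('i \<Rightarrow> real) \<Rightarrow> bool" where
  "algebraically_independent I x \<longleftrightarrow>
    (\<forall>P :: ('i \<Rightarrow>\<^sub>0 nat) \<Rightarrow>\<^sub>0 rat.
       (\<forall>m\<in>Poly_Mapping.keys P. Poly_Mapping.keys m \<subseteq> I) \<and> poly_value P x = 0 \<longrightarrow> P = 0)"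

text \<open>Realizations are total maps \<open>'a \<Rightarrow> real ^ 'd\<close>, of which only the values on the vertex set are
  ever used.\<close>

definition generic_realization :: "'a pair_pre_digraph \<Rightarrow> ('a \<Rightarrow> real ^ 'd) \<Rightarrow> bool" where
  "generic_realization G p \<longleftrightarrow>
    algebraically_independent (pverts G \<times> (UNIV :: 'd set)) (\<lambda>(v, k). p v $ k)"

definition equivalent_realizations ::
    "'a pair_pre_digraph \<Rightarrow> ('a \<Rightarrow> real ^ 'd) \<Rightarrow> ('a \<Rightarrow> real ^ 'd) \<Rightarrow> bool" where
  "equivalent_realizations G p q \<longleftrightarrow>
    (\<forall>(x, y) \<in> parcs G. norm (p x - p y) = norm (q x - q y))"

definition congruent_realizations ::
    "'a pair_pre_digraph \<Rightarrow> ('a \<Rightarrow> real ^ 'd) \<Rightarrow> ('a \<Rightarrow> real ^ 'd) \<Rightarrow> bool" where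
  "congruent_realizations G p q \<longleftrightarrow>
    (\<forall>x \<in> pverts G. \<forall>y \<in> pverts G. norm (p x - p y) = norm (q x - q y))"

section \<open>Rigidity and global rigidity\<close>

text \<open>Rigidity is a generic property: whether it is required of some or of all generic realizations
  makes no difference. We require it of all of them.\<close>

definition rigid :: "'d::finite itself \<Rightarrow> 'a pair_pre_digraph \<Rightarrow> bool" where
  "rigid (_ :: 'd itself) G \<longleftrightarrow>
    (\<forall>p :: 'a \<Rightarrow> real ^ 'd. generic_realization G p \<longrightarrow>
      (\<exists>\<epsilon> > 0. \<forall>q. equivalent_realizations G p q \<and> (\<forall>x \<in> pverts G. norm (p x - q x) < \<epsilon>) \<longrightarrow>
                   congruent_realizations G p q))"

definition globally_rigid :: "'d::finite itself \<Rightarrow> 'a pair_pre_digraph \<Rightarrow> bool" where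
  "globally_rigid (_ :: 'd itself) G \<longleftrightarrow>
    (\<forall>p :: 'a \<Rightarrow> real ^ 'd. generic_realization G p \<longrightarrow>
      (\<forall>q. equivalent_realizations G p q \<longrightarrow> congruent_realizations G p q))"

definition globally_linked :: "'d::finite itself \<Rightarrow> 'a pair_pre_digraph \<Rightarrow> 'a \<Rightarrow> 'a \<Rightarrow> bool" where
  "globally_linked (_ :: 'd itself) G x y \<longleftrightarrow>
    (\<forall>p :: 'a \<Rightarrow> real ^ 'd. generic_realization G p \<longrightarrow>
      (\<forall>q. equivalent_realizations G p q \<longrightarrow> norm (p x - p y) = norm (q x - q y)))"

definition joined :: "'d::finite itself \<Rightarrow> 'a pair_pre_digraph \<Rightarrow> bool" where
  "joined (_ :: 'd itself) G \<longleftrightarrow>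
    card (pverts G) \<ge> CARD('d) + 1 \<and>
    rigid TYPE('d) G \<and>
    (\<forall>x \<in> pverts G. \<forall>y \<in> pverts G. x \<noteq> y \<longrightarrow>
       (globally_linked TYPE('d) G x y \<longleftrightarrow>
          (x, y) \<in> parcs G \<or> local_connectivity G x y \<ge> CARD('d) + 1))"

definition globally_rigid_gluing_construction ::
    "'d::finite itself \<Rightarrow> 'a pair_pre_digraph \<Rightarrow> 'a pair_pre_digraph list \<Rightarrow> bool" where
  "globally_rigid_gluing_construction (_ :: 'd itself) G Gs \<longleftrightarrow>
    card (pverts G) \<ge> CARD('d) + 1 \<and>
    Gs \<noteq> [] \<and> last Gs = G \<and> (\<forall>H \<in> set Gs. pair_graph H) \<and>
    (\<forall>i < length Gs.
       (card (pverts (Gs ! i)) \<ge> CARD('d) + 1 \<and> globally_rigid TYPE('d) (Gs ! i)) \<or>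
       (\<exists>j l. j < l \<and> l < i \<and>
          with_proj (Gs ! i) =
            Digraph_Component.union (with_proj (Gs ! j)) (with_proj (Gs ! l)) \<and>
          pverts (Gs ! j) \<noteq> pverts (Gs ! i) \<and> pverts (Gs ! l) \<noteq> pverts (Gs ! i) \<and>
          card (pverts (Gs ! j) \<inter> pverts (Gs ! l)) \<ge> CARD('d)))"

end

theory Submission
  imports Defs "HOL-Computational_Algebra.Polynomial"
begin

text \<open>
  If \<open>G\<close> is not complete, a minimal separator \<open>S\<close> of two non-adjacent vertices is a clique (Dirac),
  has at least \<open>d\<close> elements, and splits \<open>G\<close> into two smaller induced subgraphs meeting in \<open>S\<close>, which
  inherit \<open>d\<close>-connectivity because walks can be short-cut through \<open>S\<close>. Recursion down to cliques gives
  the gluing construction. A union over \<open>d\<close> points in general position preserves local rigidity: the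
  only freedom is a reflection in the hyperplane through them, which is not close to the identity.
  A union over \<open>d + 1\<close> such points preserves congruence, so \<open>(d+1)\<close>-connected chordal graphs are
  globally rigid. Splitting along separators of size at most \<open>d\<close>, two vertices not separated by such a
  set end up in a common \<open>(d+1)\<close>-connected induced subgraph and are globally linked. Conversely, by
  Menger's theorem (proved for chordal graphs by removing simplicial vertices), non-adjacent \<open>x\<close>, \<open>y\<close>
  with \<open>\<kappa>(G, x, y) \<le> d\<close> are separated by exactly \<open>d\<close> vertices, and reflecting the component of \<open>x\<close> in
  the hyperplane spanned by them changes the distance of \<open>x\<close> and \<open>y\<close>.
\<close>

section \<open>Chordal graphs\<close>

text \<open>A given generic realization is used only through general position: any d + 1 vertices
  are affinely independent. Gluing then becomes linear algebra with Gram matrices. Fix linear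
  combinations of the common points and subtract them from a vertex of each part: whether the
  distance of the two vertices is preserved depends only on the inner product of the two remainders.
  With d + 1 common points a remainder can be made to vanish. With d common points both can be put
  on one line, and only a sign stays open. To exclude the wrong sign without carrying an epsilon
  through the recursion, local rigidity is proved for sequences of realizations that converge to the
  given one. The recursion works on vertex subsets and on a notion of connectivity without a lower
  bound on the number of vertices; the bound d + 1 for the parts is recovered from the fact that
  each part properly contains a separator of at least d vertices.\<close>

fun induced_path :: "'a rel \<Rightarrow> 'a list \<Rightarrow> bool" where
  "induced_path E [] \<longleftrightarrow> True"
| "induced_path E [v] \<longleftrightarrow> True"
| "induced_path E (u # w # p) \<longleftrightarrow>
     (u, w) \<in> E \<and> u \<notin> set (w # p) \<and> (\<forall>b\<in>set p. (u, b) \<notin> E) \<and> induced_path E (w # p)"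

lemma induced_path_appendD: "induced_path E (p @ q) \<Longrightarrow> induced_path E q"
proof (induction p)
  case (Cons u p)
  then have "induced_path E (p @ q)"
    by (cases "p @ q") auto
  then show ?case by (rule Cons.IH)
qed simp

lemma induced_path_distinct: "induced_path E p \<Longrightarrow> distinct p"
  by (induction E p rule: induced_path.induct) auto

text \<open>The recursion excludes only chords that point forward along the path; symmetry of
  \<open>E\<close> rules out the others.\<close>

lemma induced_path_adj_iff:
  assumes "induced_path E p" "sym E" "irrefl E" "a \<in> set p" "b \<in> set p"
  shows "(a, b) \<in> E \<longleftrightarrow> (a, b) \<in> set (vwalk_arcs p) \<union> (set (vwalk_arcs p))\<inverse>"
  using assms
proof (induction E p rule: induced_path.induct)
  case (2 E v)
  then show ?case by (auto simp: irrefl_def)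
next
  case (3 E u w p)
  have vs: "x \<in> set (w # p) \<and> y \<in> set (w # p)" if "(x, y) \<in> set (vwalk_arcs (w # p))" for x y
    using that by (meson in_set_vwalk_arcsE)
  have IH: "(a, b) \<in> E \<longleftrightarrow>
      (a, b) \<in> set (vwalk_arcs (w # p)) \<union> (set (vwalk_arcs (w # p)))\<inverse>"
    if "a \<in> set (w # p)" "b \<in> set (w # p)"
    using "3.IH" "3.prems"(1-3) that by simp
  have arcs: "set (vwalk_arcs (u # w # p)) = insert (u, w) (set (vwalk_arcs (w # p)))"
    by simp
  have u: "u \<notin> set (w # p)" "(u, w) \<in> E" "\<And>b. b \<in> set p \<Longrightarrow> (u, b) \<notin> E"
    "\<And>b. b \<in> set p \<Longrightarrow> (b, u) \<notin> E" "(w, u) \<in> E" "(u, u) \<notin> E"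
    using "3.prems"(1-3) by (auto dest: symD simp: irrefl_def)
  consider "a = u" "b = u" | "a = u" "b \<in> set (w # p)" | "a \<in> set (w # p)" "b = u"
    | "a \<in> set (w # p)" "b \<in> set (w # p)"
    using "3.prems"(4,5) by auto
  then show ?case
  proof cases
    case 1
    then show ?thesis unfolding arcs using u vs[of u u] by auto
  next
    case 2
    then show ?thesis unfolding arcs using u vs[of u b] vs[of b u] by auto
  next
    case 3
    then show ?thesis unfolding arcs using u vs[of u a] vs[of a u] by auto
  next
    case 4
    then have "a \<noteq> u" "b \<noteq> u" using u by auto
    then show ?thesis unfolding arcs using IH[OF 4] by auto
  qed
qed simp

text \<open>The path is built from the far end of the walk, so no shortest path has to be chosen: a
  vertex already on the path cuts it down to a suffix, and a new vertex is joined to its last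
  neighbour on the path, which leaves it no chord.\<close>

lemma rtrancl_imp_induced_path:
  assumes "(u, v) \<in> (E \<inter> X \<times> X)\<^sup>*" "v \<in> X"
  obtains p where "induced_path E p" "p \<noteq> []" "hd p = u" "last p = v" "set p \<subseteq> X"
proof -
  have "\<exists>p. induced_path E p \<and> p \<noteq> [] \<and> hd p = u \<and> last p = v \<and> set p \<subseteq> X"
    using assms(1)
  proof (induction rule: converse_rtrancl_induct)
    case base
    then show ?case using assms(2) by (intro exI[of _ "[v]"]) auto
  next
    case (step u u')
    then obtain p where p: "induced_path E p" "p \<noteq> []" "hd p = u'" "last p = v" "set p \<subseteq> X"
      by auto
    show ?case
    proof (cases "u \<in> set p")
      case True
      then obtain p1 p2 where "p = p1 @ u # p2"
        by (meson split_list)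
      then show ?thesis
        using p by (intro exI[of _ "u # p2"]) (auto dest: induced_path_appendD)
    next
      case False
      have "\<exists>w\<in>set p. (u, w) \<in> E"
        using p step by (intro bexI[of _ u']) auto
      then obtain p1 w p2 where *: "p = p1 @ w # p2" "(u, w) \<in> E" "\<forall>b\<in>set p2. (u, b) \<notin> E"
        using split_list_last_prop[of p "\<lambda>w. (u, w) \<in> E"] by blast
      then have "induced_path E (w # p2)"
        using p(1) induced_path_appendD[of E p1 "w # p2"] by simp
      then show ?thesis
        using * p step False by (intro exI[of _ "u # w # p2"]) auto
    qed
  qed
  then show ?thesis using that by blast
qed

text \<open>Library cycles are lists of arcs, while induced paths are lists of vertices; this lemma
  and the next one translate a concatenation at a common end.\<close>

lemma pawalk_verts_vwalk_arcs_append: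
  "p \<noteq> [] \<Longrightarrow> q \<noteq> [] \<Longrightarrow> last p = hd q \<Longrightarrow>
     pawalk_verts (hd p) (vwalk_arcs p @ vwalk_arcs q) = p @ tl q"
proof (induction p rule: vwalk_arcs.induct)
  case (2 x)
  have "pawalk_verts (hd q) (vwalk_arcs q) = q" if "q \<noteq> []" for q :: "'a list"
    using that by (induction q rule: vwalk_arcs.induct) auto
  then show ?case using 2 by (auto split: list.splits)
qed auto

lemma pcas_vwalk_arcs_append:
  "p \<noteq> [] \<Longrightarrow> q \<noteq> [] \<Longrightarrow> last p = hd q \<Longrightarrow>
     pcas (hd p) (vwalk_arcs p @ vwalk_arcs q) (last q)"
proof (induction p rule: vwalk_arcs.induct)
  case (2 x)
  have "pcas (hd q) (vwalk_arcs q) (last q)" if "q \<noteq> []" for q :: "'a list"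
    using that by (induction q rule: vwalk_arcs.induct) auto
  then show ?case using 2 by auto
qed auto

lemma fst_vwalk_arcs: "fst ` set (vwalk_arcs p) = set (butlast p)"
  by (induction p rule: vwalk_arcs.induct) auto

locale chordal_graph = pair_graph +
  assumes chordal: "chordal G"
begin

lemma sym_E: "sym (parcs G)"
  using pair_sym_arcs by (simp add: symmetric_def)

lemma irrefl_E: "irrefl (parcs G)"
  using pair_no_loops by (force simp: irrefl_def)

text \<open>The two paths close up to a cycle. Each path is chordless, so a chord could only join
  inner vertices of different paths, which \<open>cross\<close> forbids. As \<open>s\<close> and
  \<open>t\<close> are distinct and not adjacent, each path has at least two arcs, so the length is
  at least four.\<close>

lemma no_hole:
  assumes p: "induced_path (parcs G) p" "p \<noteq> []" "hd p = s" "last p = t"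
    and q: "induced_path (parcs G) q" "q \<noteq> []" "hd q = t" "last q = s"
    and st: "s \<noteq> t" "(s, t) \<notin> parcs G"
    and V: "set p \<subseteq> pverts G" "set q \<subseteq> pverts G"
    and disj: "set p \<inter> set q = {s, t}"
    and cross: "\<And>a b. a \<in> set p - {s, t} \<Longrightarrow> b \<in> set q - {s, t} \<Longrightarrow> (a, b) \<notin> parcs G"
  shows False
proof -
  let ?C = "vwalk_arcs p @ vwalk_arcs q"
  have len: "length r \<ge> 3"
    if "induced_path (parcs G) r" "r \<noteq> []" "hd r = a" "last r = b" "a \<noteq> b" "(a, b) \<notin> parcs G"
    for r a b
    using that by (cases r; cases "tl r"; cases "tl (tl r)") auto
  have len_arcs: "length (vwalk_arcs r) = length r - 1" for r :: "'a list"
    by (induction r rule: vwalk_arcs.induct) auto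
  have ts: "(t, s) \<notin> parcs G"
    using st sym_E by (auto dest: symD)
  have l3: "length p \<ge> 3" "length q \<ge> 3"
    using len[OF p] len[OF q] st ts by auto
  have C4: "length ?C \<ge> 4"
    using l3 len_arcs[of p] len_arcs[of q] by auto
  have dp: "distinct p" and dq: "distinct q"
    using p q induced_path_distinct by auto
  obtain p' where p': "p = s # p'" using p by (cases p) auto
  obtain q' where q': "q = t # q'" using q by (cases q) auto
  have bp: "set (butlast p) = set p - {t}" and bq: "set (butlast q) = set q - {s}"
  proof -
    have *: "set (butlast r) = set r - {last r}" if "r \<noteq> []" "distinct r" for r :: "'a list"
      using that by (cases r rule: rev_cases) auto
    show "set (butlast p) = set p - {t}" "set (butlast q) = set q - {s}"
      using *[of p] *[of q] p q dp dq by auto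
  qed
  have stin: "s \<in> set p" "t \<in> set p" "s \<in> set q" "t \<in> set q" using disj by auto
  have fstC: "fst ` set ?C = set p \<union> set q"
    using bp bq stin st by (auto simp: fst_vwalk_arcs image_Un)
  have arcs_sub: "x \<in> set r \<and> y \<in> set r" if "(x, y) \<in> set (vwalk_arcs r)" for x y and r :: "'a list"
    using that by (meson in_set_vwalk_arcsE)
  note ap = induced_path_adj_iff[OF p(1) sym_E irrefl_E]
  note aq = induced_path_adj_iff[OF q(1) sym_E irrefl_E]
  have E: "(a, b) \<in> parcs G \<longleftrightarrow> (a, b) \<in> set ?C \<union> (set ?C)\<inverse>"
    if "a \<in> set p \<union> set q" "b \<in> set p \<union> set q" for a b
  proof -
    have "(a \<in> set p \<and> b \<in> set p) \<or> (a \<in> set q \<and> b \<in> set q) \<or>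
        (a \<in> set p - {s, t} \<and> b \<in> set q - {s, t}) \<or> (b \<in> set p - {s, t} \<and> a \<in> set q - {s, t})"
      using that stin by blast
    then consider "a \<in> set p" "b \<in> set p" | "a \<in> set q" "b \<in> set q"
      | "a \<in> set p - {s, t}" "b \<in> set q - {s, t}" | "b \<in> set p - {s, t}" "a \<in> set q - {s, t}"
      by argo
    then show ?thesis
    proof cases
      case 1
      have "(a, b) \<in> set (vwalk_arcs p) \<union> (set (vwalk_arcs p))\<inverse>"
        if "(a, b) \<in> set (vwalk_arcs q) \<union> (set (vwalk_arcs q))\<inverse>"
      proof -
        have "a \<in> set q" "b \<in> set q" using that arcs_sub by auto
        then show ?thesis using that ap[OF 1] aq by blast
      qed
      then show ?thesis using ap[OF 1] by auto
    next
      case 2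
      have "(a, b) \<in> set (vwalk_arcs q) \<union> (set (vwalk_arcs q))\<inverse>"
        if "(a, b) \<in> set (vwalk_arcs p) \<union> (set (vwalk_arcs p))\<inverse>"
      proof -
        have "a \<in> set p" "b \<in> set p" using that arcs_sub by auto
        then show ?thesis using that ap aq[OF 2] by blast
      qed
      then show ?thesis using aq[OF 2] by auto
    next
      case 3
      then have "a \<notin> set q" "b \<notin> set p" using disj by auto
      then show ?thesis using cross[OF 3] arcs_sub by auto
    next
      case 4
      then have "b \<notin> set q" "a \<notin> set p" using disj by auto
      moreover have "(a, b) \<notin> parcs G" using cross[OF 4] sym_E by (auto dest: symD)
      ultimately show ?thesis using arcs_sub by auto
    qed
  qed
  have ends: "x \<in> set p \<union> set q \<and> y \<in> set p \<union> set q" if "(x, y) \<in> set ?C" for x y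
    using that arcs_sub[of x y p] arcs_sub[of x y q] by auto
  have ind: "arcs (with_proj G \<restriction> (fst ` set ?C)) = set ?C \<union> (set ?C)\<inverse>"
  proof (rule set_eqI)
    fix e :: "'a \<times> 'a"
    obtain a b where e: "e = (a, b)" by (cases e)
    show "e \<in> arcs (with_proj G \<restriction> (fst ` set ?C)) \<longleftrightarrow> e \<in> set ?C \<union> (set ?C)\<inverse>"
    proof
      assume "e \<in> arcs (with_proj G \<restriction> (fst ` set ?C))"
      then have "(a, b) \<in> parcs G" "a \<in> set p \<union> set q" "b \<in> set p \<union> set q"
        unfolding fstC e by auto
      then show "e \<in> set ?C \<union> (set ?C)\<inverse>" unfolding e by (simp only: E)
    next
      assume *: "e \<in> set ?C \<union> (set ?C)\<inverse>"
      then have "a \<in> set p \<union> set q" "b \<in> set p \<union> set q"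
        using ends[of a b] ends[of b a] unfolding e by blast+
      moreover have "(a, b) \<in> parcs G" using * calculation by (simp only: E e)
      ultimately show "e \<in> arcs (with_proj G \<restriction> (fst ` set ?C))"
        unfolding fstC e by auto
    qed
  qed
  have sub: "set ?C \<subseteq> parcs G"
  proof
    fix e assume e: "e \<in> set ?C"
    obtain a b where ab: "e = (a, b)" by (cases e)
    show "e \<in> parcs G" using e ends[of a b] E[of a b] unfolding ab by blast
  qed
  have "cycle ?C"
    unfolding cycle_def awalk_def
  proof (intro exI[of _ s] conjI)
    show "s \<in> pverts G" using stin V by auto
    show "pcas s ?C s"
      using pcas_vwalk_arcs_append[of p q] p q by auto
    have "pawalk_verts s ?C = p @ tl q"
      using pawalk_verts_vwalk_arcs_append[of p q] p q by auto
    then show "distinct (tl (pawalk_verts s ?C))"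
      using dp dq disj p' q' by auto
    show "?C \<noteq> []" using C4 by auto
  qed (rule sub)
  then show False
    using chordal ind C4 unfolding chordal_def by blast
qed

section \<open>Reachability and clique separations\<close>

abbreviation reach :: "'a set \<Rightarrow> 'a \<Rightarrow> 'a \<Rightarrow> bool" where
  "reach X u v \<equiv> (u, v) \<in> (parcs G \<inter> X \<times> X)\<^sup>*"

definition clique :: "'a set \<Rightarrow> bool" where
  "clique X \<longleftrightarrow> (\<forall>u\<in>X. \<forall>v\<in>X. u \<noteq> v \<longrightarrow> (u, v) \<in> parcs G)"

text \<open>Neither side has to be proper and the separator may be empty; properness is expressed by
  exhibiting a vertex in each of \<open>X1 - X2\<close> and \<open>X2 - X1\<close>.\<close>

definition separation :: "'a set \<Rightarrow> 'a set \<Rightarrow> 'a set \<Rightarrow> bool" where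
  "separation X X1 X2 \<longleftrightarrow> X = X1 \<union> X2 \<and> clique (X1 \<inter> X2) \<and>
     (\<forall>u\<in>X1 - X2. \<forall>v\<in>X2 - X1. (u, v) \<notin> parcs G)"

text \<open>This is k-connectivity without the lower bound on the number of vertices, so cliques of
  every size satisfy it and it passes to parts of any size. \<open>T\<close> may leave
  \<open>X\<close>, which lets the same \<open>T\<close> serve for a set and for its parts.\<close>

definition well_linked :: "nat \<Rightarrow> 'a set \<Rightarrow> bool" where
  "well_linked k X \<longleftrightarrow> (\<forall>T. finite T \<and> card T < k \<longrightarrow> (\<forall>a\<in>X - T. \<forall>b\<in>X - T. reach (X - T) a b))"

definition simplicial :: "'a set \<Rightarrow> 'a \<Rightarrow> bool" where
  "simplicial X v \<longleftrightarrow> v \<in> X \<and> clique {w \<in> X. (v, w) \<in> parcs G}"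

lemma adj_sym: "(u, v) \<in> parcs G \<Longrightarrow> (v, u) \<in> parcs G"
  using sym_E by (rule symD)

lemma adj_irrefl: "(u, u) \<notin> parcs G"
  using irrefl_E by (simp add: irrefl_def)

lemma clique_subset: "clique X \<Longrightarrow> Y \<subseteq> X \<Longrightarrow> clique Y"
  by (auto simp: clique_def)

lemma reach_sym: "reach X u v \<Longrightarrow> reach X v u"
proof -
  have "sym (parcs G \<inter> X \<times> X)"
    by (auto intro!: symI dest: adj_sym)
  then show "reach X u v \<Longrightarrow> reach X v u"
    using sym_rtrancl symD by metis
qed

lemma reach_mono: "reach X u v \<Longrightarrow> X \<subseteq> Y \<Longrightarrow> reach Y u v"
  by (erule rtrancl_mono[THEN subsetD, rotated]) auto

text \<open>The closure is reflexive, so \<open>reach X u u\<close> holds even for \<open>u\<close>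
  outside \<open>X\<close>; hence the second assumption.\<close>

lemma reach_in: "reach X u v \<Longrightarrow> u \<in> X \<Longrightarrow> v \<in> X"
  by (induction rule: rtrancl_induct) auto

lemma reach_step: "(u, v) \<in> parcs G \<Longrightarrow> u \<in> X \<Longrightarrow> v \<in> X \<Longrightarrow> reach X u v"
  by auto

text \<open>All vertices of the walk are themselves reachable from \<open>u\<close>. This allows
  walks to be confined to one component.\<close>

lemma reach_Restr_reachable:
  assumes "reach X u v"
  shows "reach {w. reach X u w} u v"
  using assms
proof (induction rule: rtrancl_induct)
  case (step v w)
  then have "reach X u w" by (meson rtrancl.rtrancl_into_rtrancl)
  then have "(v, w) \<in> parcs G \<inter> {w. reach X u w} \<times> {w. reach X u w}"
    using step by auto
  then show ?case using step.IH by (rule rtrancl_into_rtrancl[rotated])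
qed simp

text \<open>If the walk needs \<open>s\<close>, the vertex just before its first visit to
  \<open>s\<close> is the neighbour sought.\<close>

lemma reach_insert:
  assumes "reach (insert s Y) a v" "a \<in> Y"
  shows "reach Y a v \<or> (\<exists>w\<in>Y. reach Y a w \<and> (w, s) \<in> parcs G)"
  using assms(1)
proof (induction rule: rtrancl_induct)
  case (step v w)
  from step.IH show ?case
  proof
    assume v: "reach Y a v"
    then have "v \<in> Y" using assms(2) reach_in by blast
    show ?thesis
    proof (cases "w \<in> Y")
      case True
      then have "(v, w) \<in> parcs G \<inter> Y \<times> Y" using step \<open>v \<in> Y\<close> by auto
      then show ?thesis using v by (meson rtrancl.rtrancl_into_rtrancl)
    next
      case False
      then show ?thesis using step \<open>v \<in> Y\<close> v by auto
    qed
  qed blast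
qed simp

lemma separation_sym: "separation X X1 X2 \<Longrightarrow> separation X X2 X1"
  using adj_sym unfolding separation_def by (auto simp: Int_commute)

text \<open>A walk leaving \<open>X1\<close> returns through the clique \<open>X1 \<inter> X2\<close>, so it can be short-cut.\<close>

lemma separation_reach:
  assumes sep: "separation X X1 X2" and u: "u \<in> X1 - T" and v: "v \<in> X1 - T"
    and reach: "reach (X - T) u v"
  shows "reach (X1 - T) u v"
proof -
  \<comment> \<open>Invariant of the walk: while it is outside \<open>X1\<close>, a separator vertex
    reached inside \<open>X1\<close> is remembered. The vertex at which the walk returns is equal or
    adjacent to it.\<close>
  have "(v \<in> X1 \<longrightarrow> reach (X1 - T) u v) \<and>
        (v \<notin> X1 \<longrightarrow> (\<exists>s\<in>X1 \<inter> X2 - T. reach (X1 - T) u s))"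
    using reach
  proof (induction rule: rtrancl_induct)
    case base
    then show ?case using u by auto
  next
    case (step v w)
    then have vw: "(v, w) \<in> parcs G" "v \<in> X - T" "w \<in> X - T" by auto
    have into: "reach (X1 - T) u y" if "reach (X1 - T) u x" "(x, y) \<in> parcs G" "x \<in> X1 - T" "y \<in> X1 - T"
      for x y
      using that by (meson IntI SigmaI rtrancl.rtrancl_into_rtrancl)
    consider "v \<in> X1" "w \<in> X1" | "v \<in> X1" "w \<notin> X1" | "v \<notin> X1" "w \<in> X1" | "v \<notin> X1" "w \<notin> X1"
      by blast
    then show ?case
    proof cases
      case 1
      then show ?thesis using step.IH vw into by auto
    next
      case 2
      then have "v \<in> X1 \<inter> X2 - T" using vw sep by (auto simp: separation_def)
      then show ?thesis using 2 step.IH by auto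
    next
      case 3
      then obtain s where s: "s \<in> X1 \<inter> X2 - T" "reach (X1 - T) u s" using step.IH by auto
      have w: "w \<in> X1 \<inter> X2 - T"
        using 3 vw sep adj_sym unfolding separation_def by blast
      have "reach (X1 - T) u w"
      proof (cases "s = w")
        case False
        then have "(s, w) \<in> parcs G" using s w sep by (auto simp: separation_def clique_def)
        then show ?thesis using into s w by blast
      qed (use s in simp)
      then show ?thesis using 3 by simp
    next
      case 4
      then show ?thesis using step.IH by auto
    qed
  qed
  then show ?thesis using v by auto
qed

text \<open>Lying in \<open>X1 - X2\<close> is an invariant of walks that avoid the
  separator.\<close>

lemma separation_separates:
  assumes sep: "separation X X1 X2" and ab: "a \<in> X1 - X2" "b \<in> X2 - X1"
  shows "\<not> reach (X - X1 \<inter> X2) a b"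
proof
  assume "reach (X - X1 \<inter> X2) a b"
  then have "b \<in> X1 - X2"
  proof (induction rule: rtrancl_induct)
    case (step v w)
    then show ?case using sep by (auto simp: separation_def)
  qed (use ab in simp)
  then show False using ab by simp
qed

text \<open>By minimality, every separator vertex has a neighbour in the component of
  \<open>a\<close> and one in that of \<open>b\<close>. For two non-adjacent separator vertices,
  induced paths through these two components would form a hole.\<close>

lemma minimal_separator_clique:
  assumes X: "X \<subseteq> pverts G" and S: "S \<subseteq> X"
    and ab: "a \<in> X - S" "b \<in> X - S" and nreach: "\<not> reach (X - S) a b"
    and min: "\<And>s. s \<in> S \<Longrightarrow> reach (insert s (X - S)) a b"
  shows "clique S"
  unfolding clique_def
proof (intro ballI impI, rule ccontr)
  fix s t assume st: "s \<in> S" "t \<in> S" "s \<noteq> t" "(s, t) \<notin> parcs G"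
  define C where "C a = {w. reach (X - S) a w}" for a
  have C_sub: "C c \<subseteq> X - S" if "c \<in> X - S" for c
    using that reach_in by (auto simp: C_def)
  have nbr: "\<exists>w\<in>C c. (w, s) \<in> parcs G" if "s \<in> S" "c \<in> X - S" "d \<in> X - S"
    "reach (insert s (X - S)) c d" "\<not> reach (X - S) c d" for c d s
    using reach_insert[OF that(4,2)] that(5) by (auto simp: C_def)
  have nbr_a: "\<exists>w\<in>C a. (w, s) \<in> parcs G" if "s \<in> S" for s
    using nbr[OF that ab min[OF that] nreach] .
  have nbr_b: "\<exists>w\<in>C b. (w, s) \<in> parcs G" if "s \<in> S" for s
    using nbr[OF that ab(2,1)] min[OF that] nreach reach_sym by blast
  have conn: "reach (insert s (insert t (C c))) s t"
    if "w \<in> C c" "(w, s) \<in> parcs G" "w' \<in> C c" "(w', t) \<in> parcs G" for c w w' s t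
  proof -
    let ?Y = "insert s (insert t (C c))"
    have "reach ?Y c w" "reach ?Y c w'"
      using that reach_Restr_reachable[of c _ "X - S"] reach_mono[of c _ "C c" ?Y]
      unfolding C_def by blast+
    moreover have "reach ?Y s w" "reach ?Y w' t"
      using that adj_sym by (auto intro!: reach_step)
    moreover from \<open>reach ?Y c w\<close> have "reach ?Y w c" by (rule reach_sym)
    ultimately show ?thesis
      by (meson rtrancl_trans)
  qed
  obtain w w' where w: "w \<in> C a" "(w, s) \<in> parcs G" "w' \<in> C a" "(w', t) \<in> parcs G"
    using nbr_a st by blast
  obtain z z' where z: "z \<in> C b" "(z, s) \<in> parcs G" "z' \<in> C b" "(z', t) \<in> parcs G"
    using nbr_b st by blast
  obtain p where p: "induced_path (parcs G) p" "p \<noteq> []" "hd p = s" "last p = t"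
    "set p \<subseteq> insert s (insert t (C a))"
    using rtrancl_imp_induced_path[OF conn[OF w]] by blast
  obtain q where q: "induced_path (parcs G) q" "q \<noteq> []" "hd q = t" "last q = s"
    "set q \<subseteq> insert t (insert s (C b))"
    using rtrancl_imp_induced_path[OF conn[OF z(3,4,1,2)]] by blast
  have cross: "(x, y) \<notin> parcs G" "x \<noteq> y" if "x \<in> C a" "y \<in> C b" for x y
  proof -
    have r: "reach (X - S) a x" "reach (X - S) y b"
      using that reach_sym by (auto simp: C_def)
    then show "x \<noteq> y" using nreach rtrancl_trans by metis
    show "(x, y) \<notin> parcs G"
    proof
      assume "(x, y) \<in> parcs G"
      then have "reach (X - S) x y"
        using that C_sub ab by (intro reach_step) auto
      then show False using r nreach rtrancl_trans by metis
    qed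
  qed
  have "s \<in> set p" "t \<in> set p" "s \<in> set q" "t \<in> set q"
    using p q by (metis hd_in_set last_in_set)+
  moreover have "set p \<inter> set q \<subseteq> {s, t}"
    using p(5) q(5) cross(2) by blast
  ultimately have "set p \<inter> set q = {s, t}" by blast
  moreover have "set p \<subseteq> pverts G" "set q \<subseteq> pverts G"
    using p(5) q(5) C_sub ab S X st by blast+
  moreover have "(x, y) \<notin> parcs G" if "x \<in> set p - {s, t}" "y \<in> set q - {s, t}" for x y
    using that p(5) q(5) by (intro cross) auto
  ultimately show False
    using no_hole[OF p(1-4) q(1-4) st(3,4)] by blast
qed

lemma clique_separation:
  assumes X: "X \<subseteq> pverts G" and ab: "a \<in> X - T" "b \<in> X - T" and nreach: "\<not> reach (X - T) a b"
  obtains X1 X2 where "separation X X1 X2" "X1 \<inter> X2 \<subseteq> T" "a \<in> X1 - X2" "b \<in> X2 - X1"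
proof -
  have finX: "finite X" using X pair_finite_verts finite_subset by blast
  define Q where "Q S \<longleftrightarrow> S \<subseteq> T \<inter> X \<and> \<not> reach (X - S) a b" for S
  have "X - T \<inter> X = X - T" by blast
  then have "Q (T \<inter> X)" using nreach by (simp add: Q_def)
  \<comment> \<open>Least cardinality yields minimality under deletion of a single vertex, which is
    the form the clique lemma asks for. The search stays inside \<open>T \<inter> X\<close> because
    \<open>T\<close> may leave \<open>X\<close>.\<close>
  then obtain S where S: "Q S" and least: "\<And>S'. Q S' \<Longrightarrow> card S \<le> card S'"
    using ex_has_least_nat[of Q _ card] by blast
  have SX: "S \<subseteq> X" "S \<subseteq> T" and nS: "\<not> reach (X - S) a b" using S by (auto simp: Q_def)
  have abS: "a \<in> X - S" "b \<in> X - S" using ab SX by auto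
  have finS: "finite S" using finX SX finite_subset by blast
  have "reach (insert s (X - S)) a b" if "s \<in> S" for s
  proof -
    have "card (S - {s}) < card S" using that finS by (meson card_Diff1_less)
    then have "\<not> Q (S - {s})" using least leD by blast
    then have "reach (X - (S - {s})) a b" using SX by (auto simp: Q_def)
    moreover have "X - (S - {s}) = insert s (X - S)" using that SX by auto
    ultimately show ?thesis by simp
  qed
  then have clique: "clique S"
    using minimal_separator_clique[OF X SX(1) abS nS] by blast
  define C where "C = {w. reach (X - S) a w}"
  have CX: "C \<subseteq> X - S" using reach_in abS by (auto simp: C_def)
  have int: "(C \<union> S) \<inter> (X - C) = S" using CX SX by auto
  have no: "(u, v) \<notin> parcs G" if "u \<in> C" "v \<in> X - C - S" for u v
  proof
    assume "(u, v) \<in> parcs G"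
    then have "(u, v) \<in> parcs G \<inter> (X - S) \<times> (X - S)" using that CX by auto
    then have "v \<in> C" using that(1) unfolding C_def by (auto intro: rtrancl_into_rtrancl)
    then show False using that by auto
  qed
  show ?thesis
  proof
    show "separation X (C \<union> S) (X - C)"
      unfolding separation_def int using clique no CX SX by auto
    show "(C \<union> S) \<inter> (X - C) \<subseteq> T" using int SX by simp
    show "a \<in> C \<union> S - (X - C)" by (simp add: C_def)
    show "b \<in> X - C - (C \<union> S)" using abS nS by (simp add: C_def)
  qed
qed

lemma not_clique_separation:
  assumes X: "X \<subseteq> pverts G" and "\<not> clique X"
  obtains X1 X2 a b where "separation X X1 X2" "a \<in> X1 - X2" "b \<in> X2 - X1"
proof -
  obtain a b where ab: "a \<in> X" "b \<in> X" "a \<noteq> b" "(a, b) \<notin> parcs G"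
    using assms by (auto simp: clique_def)
  \<comment> \<open>Deleting everything except \<open>a\<close> and \<open>b\<close> leaves no arcs;
    a clique separator is then found inside this crude one.\<close>
  let ?T = "X - {a, b}"
  have "parcs G \<inter> (X - ?T) \<times> (X - ?T) = {}"
    using ab adj_sym adj_irrefl by auto
  then have "\<not> reach (X - ?T) a b" using ab by simp
  then obtain X1 X2 where "separation X X1 X2" "a \<in> X1 - X2" "b \<in> X2 - X1"
    using clique_separation[OF X, of a ?T b] ab by (metis DiffD2 DiffI insertCI)
  then show ?thesis by (rule that)
qed

lemma well_linked_separation:
  assumes sep: "separation X X1 X2" and "well_linked k X"
  shows "well_linked k X1"
  unfolding well_linked_def
proof (intro allI impI ballI)
  fix T a b assume *: "finite T \<and> card T < k" "a \<in> X1 - T" "b \<in> X1 - T"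
  have "X1 \<subseteq> X" using sep by (auto simp: separation_def)
  then have "reach (X - T) a b" using assms(2) * unfolding well_linked_def by blast
  then show "reach (X1 - T) a b" using separation_reach[OF sep] * by blast
qed

lemma well_linked_split:
  assumes X: "X \<subseteq> pverts G" and k: "well_linked k X" and "\<not> clique X"
  obtains X1 X2 where "separation X X1 X2" "X1 \<subset> X" "X2 \<subset> X" "k \<le> card (X1 \<inter> X2)"
    "well_linked k X1" "well_linked k X2"
proof -
  obtain X1 X2 a b where *: "separation X X1 X2" "a \<in> X1 - X2" "b \<in> X2 - X1"
    using not_clique_separation[OF X assms(3)] by metis
  then have XX: "X = X1 \<union> X2" by (auto simp: separation_def)
  have "finite (X1 \<inter> X2)" using XX X pair_finite_verts by (meson finite_Int finite_Un finite_subset)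
  then have "k \<le> card (X1 \<inter> X2)"
    using separation_separates[OF *] k * XX unfolding well_linked_def
    by (meson DiffD1 DiffD2 DiffI Int_iff UnI1 UnI2 not_le)
  moreover have "well_linked k X1" "well_linked k X2"
    using well_linked_separation[OF *(1) k] well_linked_separation[OF separation_sym[OF *(1)] k] .
  moreover have "X1 \<subset> X" "X2 \<subset> X" using * XX by auto
  ultimately show ?thesis using that *(1) by simp
qed

section \<open>Simplicial vertices\<close>

lemma clique_simplicial: "clique X \<Longrightarrow> v \<in> X \<Longrightarrow> simplicial X v"
  unfolding simplicial_def by (auto intro: clique_subset)

lemma separation_simplicial:
  assumes "separation X X1 X2" "simplicial X1 v" "v \<notin> X2"
  shows "simplicial X v"
proof -
  have "{w \<in> X. (v, w) \<in> parcs G} = {w \<in> X1. (v, w) \<in> parcs G}"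
    using assms by (auto simp: separation_def simplicial_def)
  then show ?thesis using assms by (auto simp: simplicial_def separation_def)
qed

text \<open>Each side of a clique separation contributes one vertex outside the separator. Of two
  non-adjacent simplicial vertices of a side, at most one lies in the clique
  \<open>Y \<inter> Z\<close>; the other has all its neighbours on its own side and so remains
  simplicial in \<open>X\<close>.\<close>

lemma two_simplicial:
  assumes "X \<subseteq> pverts G" "\<not> clique X"
  shows "\<exists>u v. u \<noteq> v \<and> (u, v) \<notin> parcs G \<and> simplicial X u \<and> simplicial X v"
proof -
  have "finite X" using assms pair_finite_verts finite_subset by blast
  then show ?thesis using assms
  proof (induction X rule: finite_psubset_induct)
    case (psubset X)
    obtain X1 X2 a b where *: "separation X X1 X2" "a \<in> X1 - X2" "b \<in> X2 - X1"
      using not_clique_separation[OF psubset.prems] by metis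
    have one: "\<exists>v. simplicial X v \<and> v \<in> Y - Z" if "separation X Y Z" "c \<in> Y - Z" "d \<in> Z - Y" for Y Z c d
    proof (cases "clique Y")
      case True
      then have "simplicial X c"
        using that clique_simplicial separation_simplicial[OF that(1)] by simp
      then show ?thesis using that by blast
    next
      case False
      have "Y \<subset> X" using that by (auto simp: separation_def)
      then obtain u v where uv: "u \<noteq> v" "(u, v) \<notin> parcs G" "simplicial Y u" "simplicial Y v"
        using psubset.IH[OF _ _ False] psubset.prems(1) by (metis psubset_imp_subset subset_trans)
      have "u \<in> Y" "v \<in> Y" using uv by (simp_all add: simplicial_def)
      moreover have "clique (Y \<inter> Z)" using that(1) by (simp add: separation_def)
      ultimately have "u \<notin> Z \<or> v \<notin> Z"
        using uv(1,2) by (meson IntI clique_def)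
      then show ?thesis
        using uv(3,4) separation_simplicial[OF that(1)] \<open>u \<in> Y\<close> \<open>v \<in> Y\<close> by blast
    qed
    obtain u where u: "simplicial X u" "u \<in> X1 - X2" using one[OF *] by blast
    obtain v where v: "simplicial X v" "v \<in> X2 - X1"
      using one[OF separation_sym[OF *(1)]] * by blast
    have "u \<noteq> v" "(u, v) \<notin> parcs G" using u v * by (auto simp: separation_def)
    then show ?case using u v by blast
  qed
qed

text \<open>This makes the deletion of a simplicial vertex a special case of a clique separation, so
  that walks can be short-cut past it.\<close>

lemma simplicial_separation:
  assumes "simplicial X v"
  shows "separation X (X - {v}) {w \<in> X. w = v \<or> (v, w) \<in> parcs G}"
  unfolding separation_def
proof (intro conjI ballI)
  have "(X - {v}) \<inter> {w \<in> X. w = v \<or> (v, w) \<in> parcs G} = {w \<in> X. (v, w) \<in> parcs G}"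
    using adj_irrefl by auto
  then show "clique ((X - {v}) \<inter> {w \<in> X. w = v \<or> (v, w) \<in> parcs G})"
    using assms by (simp add: simplicial_def)
  show "X = X - {v} \<union> {w \<in> X. w = v \<or> (v, w) \<in> parcs G}"
    using assms by (auto simp: simplicial_def)
  fix x y assume "x \<in> X - {v} - {w \<in> X. w = v \<or> (v, w) \<in> parcs G}"
    and "y \<in> {w \<in> X. w = v \<or> (v, w) \<in> parcs G} - (X - {v})"
  then have "y = v" "(v, x) \<notin> parcs G" by auto
  then show "(x, y) \<notin> parcs G" using adj_sym by blast
qed

lemma simplicial_reach:
  assumes "simplicial X v" "reach (X - T) a b" "a \<in> X - {v} - T" "b \<in> X - {v} - T"
  shows "reach (X - {v} - T) a b"
  by (rule separation_reach[OF simplicial_separation[OF assms(1)] assms(3,4,2)])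

section \<open>Menger's theorem for chordal graphs\<close>

definition linkage :: "'a set \<Rightarrow> 'a set \<Rightarrow> 'a set \<Rightarrow> 'a list set \<Rightarrow> bool" where
  "linkage X A B P \<longleftrightarrow> finite P \<and>
     (\<forall>p\<in>P. p \<noteq> [] \<and> distinct p \<and> set p \<subseteq> X \<and> set (vwalk_arcs p) \<subseteq> parcs G \<and>
        set p \<inter> A = {hd p} \<and> set p \<inter> B = {last p}) \<and>
     pairwise (\<lambda>p q. set p \<inter> set q = {}) P"

text \<open>\<open>T\<close> may contain vertices of \<open>A\<close> and \<open>B\<close>; taking
  \<open>T\<close> to be one of these sets, if finite, shows that it has at least \<open>k\<close>
  elements.\<close>

definition inseparable :: "nat \<Rightarrow> 'a set \<Rightarrow> 'a set \<Rightarrow> 'a set \<Rightarrow> bool" where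
  "inseparable k X A B \<longleftrightarrow>
     (\<forall>T. finite T \<and> card T < k \<longrightarrow> (\<exists>a\<in>A - T. \<exists>b\<in>B - T. reach (X - T) a b))"

lemma inseparable_sym: "inseparable k X A B \<Longrightarrow> inseparable k X B A"
  unfolding inseparable_def using reach_sym by meson

lemma linkage_rev:
  assumes "linkage X A B P"
  shows "linkage X B A (rev ` P)" "card (rev ` P) = card P"
proof -
  show "linkage X B A (rev ` P)"
    using assms adj_sym unfolding linkage_def
    by (fastforce simp: hd_rev last_rev set_vwalk_arcs_rev pairwise_def)
  show "card (rev ` P) = card P"
    by (intro card_image) auto
qed

text \<open>\<open>A\<close> is a clique through \<open>v\<close>: a walk from \<open>v\<close>
  continues through a neighbour of \<open>v\<close>, and any other start in \<open>A\<close> is such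
  a neighbour already. So the neighbourhood, again a clique, takes the place of \<open>A\<close>
  when \<open>v\<close> is deleted.\<close>

lemma inseparable_simplicial:
  assumes v: "simplicial X v" "v \<in> A" "v \<notin> B" and A: "A \<subseteq> X" "clique A" and B: "B \<subseteq> X"
    and k: "inseparable k X A B"
  shows "inseparable k (X - {v}) {w \<in> X. (v, w) \<in> parcs G} B"
  unfolding inseparable_def
proof (intro allI impI)
  fix T :: "'a set" assume T: "finite T \<and> card T < k"
  then obtain a b where ab: "a \<in> A - T" "b \<in> B - T" "reach (X - T) a b"
    using k unfolding inseparable_def by metis
  have b: "b \<in> X - {v} - T" using ab v B by auto
  obtain w where w: "w \<in> X - T" "(v, w) \<in> parcs G" "reach (X - T) w b"
  proof (cases "a = v")
    case True
    then obtain w where "(v, w) \<in> parcs G \<inter> (X - T) \<times> (X - T)" "reach (X - T) w b"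
      using ab(3) b by (metis DiffD1 DiffD2 converse_rtranclE singletonI)
    then show ?thesis using that by auto
  next
    case False
    then have "(v, a) \<in> parcs G" using A v ab by (auto simp: clique_def)
    then show ?thesis using that[of a] ab A by auto
  qed
  then have "w \<in> X - {v} - T" using adj_irrefl by auto
  then have "reach (X - {v} - T) w b"
    using simplicial_reach[OF v(1) w(3)] b by simp
  then show "\<exists>a\<in>{w \<in> X. (v, w) \<in> parcs G} - T. \<exists>b\<in>B - T. reach (X - {v} - T) a b"
    using w ab by auto
qed

text \<open>The paths that start outside \<open>A\<close> are prolonged backwards by a matching inside the clique
  formed by \<open>v\<close> and its neighbours.\<close>

lemma linkage_extend:
  defines "N v X \<equiv> {w \<in> X. (v, w) \<in> parcs G}"
  assumes v: "simplicial X v" "v \<in> A" and A: "A \<subseteq> X" "clique A" "finite A" "k \<le> card A"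
    and AB: "A \<inter> B = {}" and P: "linkage (X - {v}) (N v X) B P" "card P = k"
  shows "\<exists>P. linkage X A B P \<and> card P = k"
proof -
  let ?N = "N v X"
  define U where "U = hd ` P"
  have P1: "p \<noteq> []" "distinct p" "set p \<subseteq> X - {v}" "set (vwalk_arcs p) \<subseteq> parcs G"
      "set p \<inter> ?N = {hd p}" "set p \<inter> B = {last p}" if "p \<in> P" for p
    using P(1) that by (auto simp: linkage_def)
  have P2: "set p \<inter> set q = {}" if "p \<in> P" "q \<in> P" "p \<noteq> q" for p q
    using P(1) that by (auto simp: linkage_def pairwise_def)
  have finP: "finite P" using P(1) by (simp add: linkage_def)
  have "inj_on hd P"
  proof (rule inj_onI)
    fix p q assume *: "p \<in> P" "q \<in> P" "hd p = hd q"
    then have "hd p \<in> set p \<inter> set q" using P1(1) by (metis IntI hd_in_set)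
    then show "p = q" using P2 * by blast
  qed
  then have U: "card U = k" "finite U" using P(2) finP by (auto simp: U_def card_image)
  have UN: "U \<subseteq> ?N" unfolding U_def using P1(5) by blast
  have AN: "A \<subseteq> insert v ?N" using A v unfolding N_def clique_def by auto
  have cN: "clique ?N" using v by (simp add: simplicial_def N_def)
  \<comment> \<open>There are \<open>k\<close> heads and at least \<open>k\<close> vertices in
    \<open>A\<close>, so the heads outside \<open>A\<close> can be matched with vertices of
    \<open>A\<close> that are not heads.\<close>
  have "card (U - A) \<le> card (A - U)"
    using card_le_sym_Diff[OF U(2) A(3)] U A by simp
  then obtain g where g: "inj_on g (U - A)" "g ` (U - A) \<subseteq> A - U"
    using U A by (meson card_le_inj finite_Diff)
  have free: "x \<notin> set p" if "x \<in> A - U" "p \<in> P" for x p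
  proof
    assume x: "x \<in> set p"
    then have "x \<in> ?N" using P1(3)[OF that(2)] AN that by auto
    then have "x = hd p" using P1(5)[OF that(2)] x by auto
    then show False using that by (simp add: U_def)
  qed
  have gE: "(g u, u) \<in> parcs G" if "u \<in> U - A" for u
  proof -
    have gu: "g u \<in> A - U" "u \<in> ?N" using g that UN by auto
    show ?thesis
    proof (cases "g u = v")
      case True
      then show ?thesis using gu by (simp add: N_def)
    next
      case False
      then have "g u \<in> ?N" "g u \<noteq> u" using gu AN that by auto
      then show ?thesis using cN gu by (auto simp: clique_def)
    qed
  qed
  define ext where "ext p = (if hd p \<in> A then p else g (hd p) # p)" for p
  have hdU: "hd p \<in> U" if "p \<in> P" for p using that by (simp add: U_def)
  have gp: "g (hd p) \<in> A - U" if "p \<in> P" "hd p \<notin> A" for p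
    using g(2) hdU that by blast
  have pA: "set p \<inter> A = (if hd p \<in> A then {hd p} else {})" if "p \<in> P" for p
  proof -
    have "x = hd p" if "x \<in> set p" "x \<in> A" for x
    proof -
      have "x \<in> U" using free \<open>p \<in> P\<close> that by blast
      then have "x \<in> ?N" using UN by blast
      then show ?thesis using P1(5)[OF \<open>p \<in> P\<close>] that by blast
    qed
    then have "set p \<inter> A \<subseteq> {hd p}" by blast
    moreover have "hd p \<in> set p" using P1(1)[OF that] by simp
    ultimately show ?thesis by auto
  qed
  have one: "ext p \<noteq> [] \<and> distinct (ext p) \<and> set (ext p) \<subseteq> X \<and> set (vwalk_arcs (ext p)) \<subseteq> parcs G \<and>
      set (ext p) \<inter> A = {hd (ext p)} \<and> set (ext p) \<inter> B = {last (ext p)}" if p: "p \<in> P" for p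
  proof (cases "hd p \<in> A")
    case True
    then show ?thesis using P1[OF p] pA[OF p] by (auto simp: ext_def)
  next
    case False
    have "set (vwalk_arcs (g (hd p) # p)) = insert (g (hd p), hd p) (set (vwalk_arcs p))"
      using P1(1)[OF p] by (cases p) auto
    moreover have "(g (hd p), hd p) \<in> parcs G" using gE hdU[OF p] False by simp
    moreover have "g (hd p) \<notin> set p" using free gp p False by blast
    moreover have "g (hd p) \<in> A" "g (hd p) \<notin> B" "g (hd p) \<in> X" using gp[OF p False] A AB by auto
    ultimately show ?thesis using P1[OF p] pA[OF p] False by (auto simp: ext_def)
  qed
  have two: "set (ext p) \<inter> set (ext q) = {}" if pq: "p \<in> P" "q \<in> P" "p \<noteq> q" for p q
  proof -
    have "g (hd p) \<noteq> g (hd q)" if "hd p \<notin> A" "hd q \<notin> A"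
      using g(1) hdU pq that \<open>inj_on hd P\<close> by (auto simp: inj_on_def)
    moreover have "g (hd p) \<notin> set q" if "hd p \<notin> A" using free[OF gp] that pq by simp
    moreover have "g (hd q) \<notin> set p" if "hd q \<notin> A" using free[OF gp] that pq by simp
    ultimately show ?thesis using P2[OF pq] by (auto simp: ext_def)
  qed
  have "inj_on ext P"
  proof (rule inj_onI, rule ccontr)
    fix p q assume *: "p \<in> P" "q \<in> P" "ext p = ext q" "p \<noteq> q"
    then show False using two[OF *(1,2,4)] one[OF *(1)] by simp
  qed
  then have "card (ext ` P) = k" using P(2) by (simp add: card_image)
  moreover have "\<forall>p\<in>P. \<forall>q\<in>P. ext p \<noteq> ext q \<longrightarrow> set (ext p) \<inter> set (ext q) = {}"
    using two by metis
  then have "linkage X A B (ext ` P)"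
    unfolding linkage_def pairwise_def using finP one by simp
  ultimately show ?thesis by blast
qed

lemma linkage_mono:
  assumes "linkage Y A B P" "Y \<subseteq> X" "A' \<inter> Y = A \<inter> Y" "B' \<inter> Y = B \<inter> Y"
  shows "linkage X A' B' P"
proof -
  have "set p \<inter> A' = set p \<inter> A" "set p \<inter> B' = set p \<inter> B" if "set p \<subseteq> Y" for p
    using assms that by blast+
  then show ?thesis
    using assms(1) subset_trans[OF _ assms(2)] unfolding linkage_def by simp
qed

text \<open>A simplicial vertex outside \<open>A\<close> and \<open>B\<close> is dropped; one in
  \<open>A\<close> is deleted by moving \<open>A\<close> to its neighbourhood, which keeps the
  clique property alive, and symmetrically for \<open>B\<close>. Common vertices are taken out
  first, because a path prolonged into \<open>A\<close> must not hit \<open>B\<close> there.\<close>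

lemma linkage_exists:
  assumes "X \<subseteq> pverts G" "A \<subseteq> X" "B \<subseteq> X" "clique A" "clique B" "inseparable k X A B"
  shows "\<exists>P. linkage X A B P \<and> card P = k"
proof -
  have "finite X" using assms pair_finite_verts finite_subset by blast
  then show ?thesis using assms
  proof (induction X arbitrary: A B k rule: finite_psubset_induct)
    case (psubset X)
    note k = \<open>inseparable k X A B\<close>
    have fin: "finite A" "finite B" using psubset finite_subset by metis+
    have V: "X - {v} \<subseteq> pverts G" for v using psubset.prems by blast
    have leA: "k \<le> card A" and leB: "k \<le> card B"
      using k fin unfolding inseparable_def by (metis Diff_cancel empty_iff not_le)+
    show ?case
    proof (cases "k = 0")
      case True
      then show ?thesis by (intro exI[of _ "{}"]) (auto simp: linkage_def)
    next
      case k0: False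
      show ?thesis
      proof (cases "A \<inter> B = {}")
        case False
        then obtain v where v: "v \<in> A" "v \<in> B" by blast
        \<comment> \<open>A common vertex serves as the path \<open>[v]\<close> and costs one unit
          of \<open>k\<close>.\<close>
        have "inseparable (k - 1) (X - {v}) (A - {v}) (B - {v})"
          unfolding inseparable_def
        proof (intro allI impI)
          fix T :: "'a set" assume "finite T \<and> card T < k - 1"
          then have "finite (insert v T) \<and> card (insert v T) < k"
            using card_insert_le_m1[of "k - 1" T v] k0 by (auto simp: card_insert_if)
          then obtain a b where ab: "a \<in> A - insert v T" "b \<in> B - insert v T"
            and r: "reach (X - insert v T) a b"
            using k unfolding inseparable_def by metis
          have "X - insert v T = X - {v} - T" by auto
          with r have "reach (X - {v} - T) a b" by simp
          moreover have "a \<in> A - {v} - T" "b \<in> B - {v} - T" using ab by auto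
          ultimately show "\<exists>a\<in>A - {v} - T. \<exists>b\<in>B - {v} - T. reach (X - {v} - T) a b"
            by metis
        qed
        moreover have "X - {v} \<subset> X" "A - {v} \<subseteq> X - {v}" "B - {v} \<subseteq> X - {v}"
          "clique (A - {v})" "clique (B - {v})"
          using v psubset.prems clique_subset by (auto intro: clique_subset)
        ultimately obtain P where P: "linkage (X - {v}) (A - {v}) (B - {v}) P" "card P = k - 1"
          using psubset.IH[OF _ V] by metis
        have "linkage (X - {v}) A B P"
          by (rule linkage_mono[OF P(1)]) auto
        then have "linkage X A B (insert [v] P)" "[v] \<notin> P"
          using v psubset.prems by (auto simp: linkage_def pairwise_insert)
        then show ?thesis
          using P k0 by (intro exI[of _ "insert [v] P"]) (auto simp: linkage_def)
      next
        case AB: True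
        have "A \<noteq> {}" using leA k0 by auto
        then have "X \<noteq> {}" using psubset.prems by auto
        then obtain v where v: "simplicial X v"
          using clique_simplicial two_simplicial[OF psubset.prems(1)] by (metis all_not_in_conv)
        then have vX: "v \<in> X" by (simp add: simplicial_def)
        then have X': "X - {v} \<subset> X" by auto
        let ?N = "{w \<in> X. (v, w) \<in> parcs G}"
        have N: "?N \<subseteq> X - {v}" "clique ?N"
          using v adj_irrefl by (auto simp: simplicial_def)
        consider "v \<in> A" "v \<notin> B" | "v \<in> B" "v \<notin> A" | "v \<notin> A" "v \<notin> B" using AB by auto
        then show ?thesis
        proof cases
          case 1
          have ins: "inseparable k (X - {v}) ?N B"
            using inseparable_simplicial[OF v 1] psubset.prems by simp
          have B: "B \<subseteq> X - {v}" using 1 psubset.prems by auto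
          obtain P where "linkage (X - {v}) ?N B P" "card P = k"
            using psubset.IH[OF X' V N(1) B N(2) psubset.prems(5) ins] by auto
          then show ?thesis
            by (rule linkage_extend[OF v 1(1) psubset.prems(2,4) fin(1) leA AB])
        next
          case 2
          have ins: "inseparable k (X - {v}) ?N A"
            using inseparable_simplicial[OF v 2] psubset.prems inseparable_sym by simp
          have A: "A \<subseteq> X - {v}" using 2 psubset.prems by auto
          obtain P where P: "linkage (X - {v}) ?N A P" "card P = k"
            using psubset.IH[OF X' V N(1) A N(2) psubset.prems(4) ins] by auto
          have "B \<inter> A = {}" using AB by auto
          then obtain P where "linkage X B A P" "card P = k"
            using linkage_extend[OF v 2(1) psubset.prems(3,5) fin(2) leB _ P] by auto
          then show ?thesis using linkage_rev by metis
        next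
          case 3
          have ins: "inseparable k (X - {v}) A B"
            unfolding inseparable_def
          proof (intro allI impI)
            fix T :: "'a set" assume "finite T \<and> card T < k"
            then obtain a b where ab: "a \<in> A - T" "b \<in> B - T" "reach (X - T) a b"
              using k unfolding inseparable_def by metis
            moreover have "a \<in> X - {v} - T" "b \<in> X - {v} - T" using ab 3 psubset.prems by auto
            ultimately show "\<exists>a\<in>A - T. \<exists>b\<in>B - T. reach (X - {v} - T) a b"
              using simplicial_reach[OF v] by metis
          qed
          have "A \<subseteq> X - {v}" "B \<subseteq> X - {v}" using 3 psubset.prems by auto
          then obtain P where "linkage (X - {v}) A B P" "card P = k"
            using psubset.IH[OF X' V _ _ psubset.prems(4,5) ins] by auto
          then show ?thesis using linkage_mono[of "X - {v}" A B P X A B] by auto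
        qed
      qed
    qed
  qed
qed

text \<open>Simplicial vertices other than \<open>x\<close> and \<open>y\<close> can be deleted.
  When none is left, the two that a non-complete chordal graph must have are \<open>x\<close> and
  \<open>y\<close> themselves. Their neighbourhoods are then cliques, and a linkage between these
  gives the inner parts of the paths.\<close>

lemma chordal_menger:
  assumes "X \<subseteq> pverts G" "x \<in> X" "y \<in> X" "x \<noteq> y" "(x, y) \<notin> parcs G"
    and "\<And>T. finite T \<Longrightarrow> card T < k \<Longrightarrow> x \<notin> T \<Longrightarrow> y \<notin> T \<Longrightarrow> reach (X - T) x y"
  shows "\<exists>P. finite P \<and> card P = k \<and> P \<subseteq> paths_between G x y \<and> pairwise (\<lambda>p q. set p \<inter> set q = {x, y}) P"
proof -
  have "finite X" using assms pair_finite_verts finite_subset by blast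
  then show ?thesis using assms
  proof (induction X rule: finite_psubset_induct)
    case (psubset X)
    note xy = psubset.prems(2-5)
    have V: "X - {v} \<subseteq> pverts G" for v using psubset.prems by blast
    show ?case
    proof (cases "\<exists>v. simplicial X v \<and> v \<noteq> x \<and> v \<noteq> y")
      case True
      then obtain v where v: "simplicial X v" "v \<noteq> x" "v \<noteq> y" by blast
      then have "X - {v} \<subset> X" by (auto simp: simplicial_def)
      moreover have "reach (X - {v} - T) x y" if "finite T" "card T < k" "x \<notin> T" "y \<notin> T" for T
        using simplicial_reach[OF v(1) psubset.prems(6)[OF that]] that xy v by auto
      moreover have "x \<in> X - {v}" "y \<in> X - {v}" using xy v by auto
      ultimately show ?thesis using psubset.IH[OF _ V _ _ xy(3,4)] by metis
    next
      case False
      have "\<not> clique X" using xy by (auto simp: clique_def)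
      then obtain u w where uw: "u \<noteq> w" "simplicial X u" "simplicial X w"
        using two_simplicial[OF psubset.prems(1)] by metis
      then have sx: "simplicial X x" and sy: "simplicial X y" using False by metis+
      define A where "A = {w \<in> X. (x, w) \<in> parcs G}"
      define B where "B = {w \<in> X. (y, w) \<in> parcs G}"
      define Y where "Y = X - {x} - {y}"
      have AB: "A \<subseteq> Y" "B \<subseteq> Y"
        using xy adj_irrefl adj_sym by (auto simp: A_def B_def Y_def)
      have cl: "clique A" "clique B" using sx sy by (auto simp: simplicial_def A_def B_def)
      have sy': "simplicial (X - {x}) y"
        using sy xy by (auto simp: simplicial_def intro: clique_subset)
      have "inseparable k Y A B"
        unfolding inseparable_def
      proof (intro allI impI)
        fix T0 :: "'a set" assume T0: "finite T0 \<and> card T0 < k"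
        \<comment> \<open>The hypothesis covers only sets that avoid \<open>x\<close> and
          \<open>y\<close>; dropping these two from \<open>T0\<close> does not change
          \<open>Y - T0\<close>.\<close>
        define T where "T = T0 - {x} - {y}"
        have "card T \<le> card T0" using T0 by (auto simp: T_def intro: card_mono)
        then have T: "finite T" "card T < k" "x \<notin> T" "y \<notin> T" using T0 by (auto simp: T_def)
        then have "reach (X - T) x y" by (rule psubset.prems(6))
        then obtain a where a: "(x, a) \<in> parcs G \<inter> (X - T) \<times> (X - T)" "reach (X - T) a y"
          using xy(3) by (metis converse_rtranclE)
        have ay: "a \<noteq> y" using a xy(4) by auto
        obtain b where b: "(b, y) \<in> parcs G \<inter> (X - T) \<times> (X - T)" "reach (X - T) a b"
          using a(2) ay by (metis rtranclE)
        have bx: "b \<noteq> x" using b xy(4) by auto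
        have ax: "a \<noteq> x" "b \<noteq> y" using a b adj_irrefl by auto
        have r: "reach (X - {x} - T) a b"
          using simplicial_reach[OF sx b(2)] a b ax bx by auto
        have "reach (Y - T) a b"
          using simplicial_reach[OF sy' r] a b ax bx ay unfolding Y_def by auto
        moreover have "Y - T = Y - T0" by (auto simp: Y_def T_def)
        moreover have "a \<in> A - T0" "b \<in> B - T0"
          using a b ax bx ay adj_sym by (auto simp: A_def B_def T_def)
        ultimately show "\<exists>a\<in>A - T0. \<exists>b\<in>B - T0. reach (Y - T0) a b" by auto
      qed
      moreover have YV: "Y \<subseteq> pverts G" using psubset.prems by (auto simp: Y_def)
      ultimately obtain P where P: "linkage Y A B P" "card P = k"
        using linkage_exists[OF _ AB cl] by metis
      define ext where "ext p = x # p @ [y]" for p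
      have P1: "p \<noteq> []" "distinct p" "set p \<subseteq> Y" "set (vwalk_arcs p) \<subseteq> parcs G"
        "hd p \<in> A" "last p \<in> B" if "p \<in> P" for p
        using P(1) that by (auto simp: linkage_def)
      have "ext p \<in> paths_between G x y" if p: "p \<in> P" for p
      proof -
        have "set (vwalk_arcs (ext p)) = insert (x, hd p) (set (vwalk_arcs (p @ [y])))"
          using P1(1)[OF p] unfolding ext_def by (cases p) simp_all
        then have "set (vwalk_arcs (ext p)) = insert (x, hd p) (insert (last p, y) (set (vwalk_arcs p)))"
          using P1(1)[OF p] by (simp add: set_vwalk_arcs_snoc)
        moreover have "(x, hd p) \<in> parcs G" "(last p, y) \<in> parcs G"
          using P1(5,6)[OF p] adj_sym by (auto simp: A_def B_def)
        moreover have "set (ext p) \<subseteq> pverts G" "distinct (ext p)"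
          using P1(2,3)[OF p] YV psubset.prems(1) xy by (auto simp: ext_def Y_def)
        ultimately show ?thesis
          using P1(4)[OF p] by (auto simp: paths_between_def vpath_def vwalk_def ext_def)
      qed
      moreover have "set (ext p) \<inter> set (ext q) = {x, y}" if "p \<in> P" "q \<in> P" "p \<noteq> q" for p q
        using P(1) that P1(3) by (auto simp: linkage_def pairwise_def ext_def)
      moreover have "card (ext ` P) = k"
        using P(2) by (subst card_image) (auto simp: inj_on_def ext_def)
      moreover have "finite P" using P(1) by (simp add: linkage_def)
      ultimately show ?thesis
        by (intro exI[of _ "ext ` P"]) (auto simp: pairwise_def)
    qed
  qed
qed

end

section \<open>Generic points\<close>

definition monomial_value :: "('i \<Rightarrow>\<^sub>0 nat) \<Rightarrow> ('i \<Rightarrow> real) \<Rightarrow> real" where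
  "monomial_value m x = (\<Prod>i\<in>Poly_Mapping.keys m. x i ^ Poly_Mapping.lookup m i)"

lemma monomial_value_superset:
  assumes "finite S" "Poly_Mapping.keys m \<subseteq> S"
  shows "monomial_value m x = (\<Prod>i\<in>S. x i ^ Poly_Mapping.lookup m i)"
  unfolding monomial_value_def using assms by (intro prod.mono_neutral_left) (auto simp: in_keys_iff)

lemma monomial_value_add: "monomial_value (m + n) x = monomial_value m x * monomial_value n x"
proof -
  let ?S = "Poly_Mapping.keys m \<union> Poly_Mapping.keys n"
  have "monomial_value k x = (\<Prod>i\<in>?S. x i ^ Poly_Mapping.lookup k i)" if "Poly_Mapping.keys k \<subseteq> ?S" for k
    using that by (intro monomial_value_superset) auto
  then show ?thesis
    using keys_add[of m n] by (simp add: lookup_add power_add prod.distrib)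
qed

lemma poly_value_eq:
  "poly_value P x = (\<Sum>m\<in>Poly_Mapping.keys P. of_rat (Poly_Mapping.lookup P m) * monomial_value m x)"
  by (simp add: poly_value_def monomial_value_def)

lemma poly_value_superset:
  assumes "finite S" "Poly_Mapping.keys P \<subseteq> S"
  shows "poly_value P x = (\<Sum>m\<in>S. of_rat (Poly_Mapping.lookup P m) * monomial_value m x)"
  unfolding poly_value_eq using assms by (intro sum.mono_neutral_left) (auto simp: in_keys_iff)

lemma poly_value_zero: "poly_value 0 x = 0"
  by (simp add: poly_value_eq)

lemma poly_value_add: "poly_value (P + Q) x = poly_value P x + poly_value Q x"
proof -
  let ?S = "Poly_Mapping.keys P \<union> Poly_Mapping.keys Q"
  have "poly_value R x = (\<Sum>m\<in>?S. of_rat (Poly_Mapping.lookup R m) * monomial_value m x)"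
    if "Poly_Mapping.keys R \<subseteq> ?S" for R
    using that by (intro poly_value_superset) auto
  then show ?thesis
    using keys_add[of P Q] by (simp add: lookup_add of_rat_add distrib_right sum.distrib)
qed

lemma poly_value_sum: "poly_value (\<Sum>a\<in>A. P a) x = (\<Sum>a\<in>A. poly_value (P a) x)"
  by (induction A rule: infinite_finite_induct) (simp_all add: poly_value_zero poly_value_add)

lemma poly_value_single: "poly_value (Poly_Mapping.single m c) x = of_rat c * monomial_value m x"
  by (simp add: poly_value_eq)

lemma sum_single_keys: "(\<Sum>m\<in>Poly_Mapping.keys P. Poly_Mapping.single m (Poly_Mapping.lookup P m)) = P"
  by (rule poly_mapping_eqI) (auto simp: lookup_sum lookup_single in_keys_iff when_def sum.delta)

lemma poly_value_mult: "poly_value (P * Q) x = poly_value P x * poly_value Q x"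
proof -
  let ?s = "\<lambda>P m. Poly_Mapping.single m (Poly_Mapping.lookup P m)"
  have "P * Q = (\<Sum>m\<in>Poly_Mapping.keys P. \<Sum>n\<in>Poly_Mapping.keys Q. ?s P m * ?s Q n)"
    by (subst sum_product[symmetric]) (simp add: sum_single_keys)
  then have "poly_value (P * Q) x =
      (\<Sum>m\<in>Poly_Mapping.keys P. \<Sum>n\<in>Poly_Mapping.keys Q. poly_value (?s P m * ?s Q n) x)"
    by (simp add: poly_value_sum)
  also have "\<dots> = (\<Sum>m\<in>Poly_Mapping.keys P. \<Sum>n\<in>Poly_Mapping.keys Q.
      (of_rat (Poly_Mapping.lookup P m) * monomial_value m x) *
      (of_rat (Poly_Mapping.lookup Q n) * monomial_value n x))"
    by (simp add: mult_single poly_value_single monomial_value_add of_rat_mult mult_ac)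
  also have "\<dots> = poly_value P x * poly_value Q x"
    by (simp add: poly_value_eq sum_product)
  finally show ?thesis .
qed

text \<open>Passing to functions turns closure under sums, products and determinants into
  introduction rules, so no explicit polynomial has to be written down for a determinant.\<close>

definition rational_polynomial_function :: "'i set \<Rightarrow> (('i \<Rightarrow> real) \<Rightarrow> real) \<Rightarrow> bool" where
  "rational_polynomial_function I f \<longleftrightarrow>
     (\<exists>P. (\<forall>m\<in>Poly_Mapping.keys P. Poly_Mapping.keys m \<subseteq> I) \<and> poly_value P = f)"

lemma rational_polynomial_const: "rational_polynomial_function I (\<lambda>x. of_rat c)"
  unfolding rational_polynomial_function_def
  by (intro exI[of _ "Poly_Mapping.single 0 c"])
     (auto simp: fun_eq_iff poly_value_single poly_value_zero monomial_value_def)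

lemma rational_polynomial_var: "i \<in> I \<Longrightarrow> rational_polynomial_function I (\<lambda>x. x i)"
  unfolding rational_polynomial_function_def
  by (intro exI[of _ "Poly_Mapping.single (Poly_Mapping.single i 1) 1"])
     (auto simp: poly_value_single monomial_value_def)

lemma rational_polynomial_add:
  assumes "rational_polynomial_function I f" "rational_polynomial_function I g"
  shows "rational_polynomial_function I (\<lambda>x. f x + g x)"
proof -
  obtain P Q where "\<forall>m\<in>Poly_Mapping.keys P. Poly_Mapping.keys m \<subseteq> I" "poly_value P = f"
    "\<forall>m\<in>Poly_Mapping.keys Q. Poly_Mapping.keys m \<subseteq> I" "poly_value Q = g"
    using assms unfolding rational_polynomial_function_def by metis
  then show ?thesis
    using keys_add[of P Q] unfolding rational_polynomial_function_def
    by (intro exI[of _ "P + Q"]) (auto simp: poly_value_add)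
qed

lemma rational_polynomial_mult:
  assumes "rational_polynomial_function I f" "rational_polynomial_function I g"
  shows "rational_polynomial_function I (\<lambda>x. f x * g x)"
proof -
  obtain P Q where PQ: "\<forall>m\<in>Poly_Mapping.keys P. Poly_Mapping.keys m \<subseteq> I" "poly_value P = f"
    "\<forall>m\<in>Poly_Mapping.keys Q. Poly_Mapping.keys m \<subseteq> I" "poly_value Q = g"
    using assms unfolding rational_polynomial_function_def by metis
  have "Poly_Mapping.keys m \<subseteq> I" if m: "m \<in> Poly_Mapping.keys (P * Q)" for m
  proof -
    obtain a b where "m = a + b" "a \<in> Poly_Mapping.keys P" "b \<in> Poly_Mapping.keys Q"
      using keys_mult[of P Q] m by auto
    then show ?thesis using keys_add[of a b] PQ by blast
  qed
  then show ?thesis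
    using PQ unfolding rational_polynomial_function_def
    by (intro exI[of _ "P * Q"]) (auto simp: poly_value_mult)
qed

lemma rational_polynomial_diff:
  assumes "rational_polynomial_function I f" "rational_polynomial_function I g"
  shows "rational_polynomial_function I (\<lambda>x. f x - g x)"
  using rational_polynomial_add[OF assms(1) rational_polynomial_mult[OF rational_polynomial_const[of I "-1"] assms(2)]]
  by (simp add: of_rat_minus)

lemma rational_polynomial_sum:
  assumes "\<And>a. a \<in> A \<Longrightarrow> rational_polynomial_function I (f a)"
  shows "rational_polynomial_function I (\<lambda>x. \<Sum>a\<in>A. f a x)"
  using assms rational_polynomial_const[of I 0]
  by (induction A rule: infinite_finite_induct) (auto intro: rational_polynomial_add)

lemma rational_polynomial_prod:
  assumes "\<And>a. a \<in> A \<Longrightarrow> rational_polynomial_function I (f a)"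
  shows "rational_polynomial_function I (\<lambda>x. \<Prod>a\<in>A. f a x)"
  using assms rational_polynomial_const[of I 1]
  by (induction A rule: infinite_finite_induct) (auto intro: rational_polynomial_mult)

lemma rational_polynomial_det:
  fixes M :: "('i \<Rightarrow> real) \<Rightarrow> real ^ 'n ^ 'n"
  assumes "\<And>i j. rational_polynomial_function I (\<lambda>x. M x $ i $ j)"
  shows "rational_polynomial_function I (\<lambda>x. det (M x))"
proof -
  have "rational_polynomial_function I (\<lambda>x. of_int k)" for k
    using rational_polynomial_const[of I "of_int k"] by simp
  then show ?thesis
    unfolding det_def
    by (intro rational_polynomial_sum rational_polynomial_mult rational_polynomial_prod assms)
qed

text \<open>A single point \<open>y\<close> shows that the polynomial behind \<open>f\<close> is not
  zero. Non-degeneracy at a generic point is thus reduced to one explicit example.\<close>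

lemma algebraically_independent_nonzero:
  assumes "algebraically_independent I x" "rational_polynomial_function I f" "f y \<noteq> 0"
  shows "f x \<noteq> 0"
proof
  assume "f x = 0"
  obtain P where P: "\<forall>m\<in>Poly_Mapping.keys P. Poly_Mapping.keys m \<subseteq> I" "poly_value P = f"
    using assms(2) unfolding rational_polynomial_function_def by metis
  then have "P = 0"
    using assms(1) \<open>f x = 0\<close> unfolding algebraically_independent_def by blast
  then show False using P assms(3) poly_value_zero[of y] by simp
qed

lemma algebraically_independent_points:
  fixes p :: "'a \<Rightarrow> real ^ 'd"
  assumes gen: "algebraically_independent (V \<times> (UNIV :: 'd set)) (\<lambda>(v, k). p v $ k)"
    and V: "s0 \<in> V" "S \<subseteq> V" "s0 \<notin> S" and S: "finite S" "card S = CARD('d)"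
    and sum0: "(\<Sum>v\<in>S. c v *\<^sub>R (p v - p s0)) = 0" and v: "v \<in> S"
  shows "c v = 0"
proof -
  have "card (UNIV :: 'd set) = card S" using S by simp
  then obtain f where f: "bij_betw f (UNIV :: 'd set) S"
    using S(1) finite_same_card_bij[of "UNIV :: 'd set" S] by auto
  define M :: "('a \<times> 'd \<Rightarrow> real) \<Rightarrow> real ^ 'd ^ 'd" where
    "M x = (\<chi> i j. x (f i, j) - x (s0, j))" for x
  have fS: "f i \<in> S" for i using f by (auto simp: bij_betw_def)
  have "rational_polynomial_function (V \<times> UNIV) (\<lambda>x. M x $ i $ j)" for i j
    using fS[of i] V unfolding M_def
    by (auto intro!: rational_polynomial_diff rational_polynomial_var)
  then have "rational_polynomial_function (V \<times> UNIV) (\<lambda>x. det (M x))"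
    by (rule rational_polynomial_det)
  \<comment> \<open>The example puts \<open>f k\<close> at the k-th unit vector and
    \<open>s0\<close> at the origin.\<close>
  moreover have "M (\<lambda>(v, k). if v = f k then 1 else 0) = mat 1"
  proof -
    have "f i = f j \<longleftrightarrow> i = j" for i j using f by (auto simp: bij_betw_def inj_on_def)
    moreover have "s0 \<noteq> f j" for j using fS[of j] V by auto
    ultimately show ?thesis by (simp add: M_def mat_def vec_eq_iff)
  qed
  then have "det (M (\<lambda>(v, k). if v = f k then 1 else 0)) \<noteq> 0" by simp
  ultimately have det: "det (M (\<lambda>(v, k). p v $ k)) \<noteq> 0"
    by (rule algebraically_independent_nonzero[OF gen])
  define N where "N = M (\<lambda>(v, k). p v $ k)"
  have "invertible N" using det by (simp add: invertible_det_nz N_def)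
  then have "\<exists>B. N ** B = mat 1" unfolding invertible_def by auto
  then have ind: "\<forall>c. (\<Sum>i\<in>UNIV. c i *s row i N) = 0 \<longrightarrow> (\<forall>i. c i = 0)"
    by (simp only: matrix_right_invertible_independent_rows)
  have row: "row i N = p (f i) - p s0" for i
    by (simp add: N_def M_def row_def vec_eq_iff)
  have "(\<Sum>i\<in>UNIV. c (f i) *s row i N) = (\<Sum>v\<in>S. c v *\<^sub>R (p v - p s0))"
    unfolding row sum.reindex_bij_betw[OF f, symmetric] by (simp add: scalar_mult_eq_scaleR)
  then have "c (f i) = 0" for i
    using ind[rule_format, of "\<lambda>i. c (f i)"] sum0 by simp
  then show ?thesis using v f by (auto simp: bij_betw_def)
qed

section \<open>Existence of generic points\<close>

lemma countable_poly_mappings: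
  fixes A :: "'k set"
  assumes "countable A"
  shows "countable {P :: 'k \<Rightarrow>\<^sub>0 'v :: {zero, countable}. Poly_Mapping.keys P \<subseteq> A}"
proof (rule countable_image_inj_on)
  \<comment> \<open>A finitely supported map is determined by its graph over the support, which is a
    finite set.\<close>
  let ?g = "\<lambda>P :: 'k \<Rightarrow>\<^sub>0 'v. (\<lambda>k. (k, Poly_Mapping.lookup P k)) ` Poly_Mapping.keys P"
  have "?g ` {P. Poly_Mapping.keys P \<subseteq> A} \<subseteq> {F. finite F \<and> F \<subseteq> A \<times> UNIV}"
    by auto
  moreover have "countable {F :: ('k \<times> 'v) set. finite F \<and> F \<subseteq> A \<times> UNIV}"
    using assms by (intro countable_Collect_finite_subset) auto
  ultimately show "countable (?g ` {P. Poly_Mapping.keys P \<subseteq> A})"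
    using countable_subset by blast
  show "inj_on ?g {P. Poly_Mapping.keys P \<subseteq> A}"
  proof (rule inj_onI, rule poly_mapping_eqI)
    fix P Q :: "'k \<Rightarrow>\<^sub>0 'v" and k
    assume eq: "?g P = ?g Q"
    have "(k, Poly_Mapping.lookup P k) \<in> ?g P \<longleftrightarrow> Poly_Mapping.lookup P k \<noteq> 0"
      "(k, Poly_Mapping.lookup Q k) \<in> ?g Q \<longleftrightarrow> Poly_Mapping.lookup Q k \<noteq> 0"
      by (auto simp: in_keys_iff)
    moreover have "(k, Poly_Mapping.lookup P k) \<in> ?g Q \<Longrightarrow> Poly_Mapping.lookup P k = Poly_Mapping.lookup Q k"
      "(k, Poly_Mapping.lookup Q k) \<in> ?g P \<Longrightarrow> Poly_Mapping.lookup P k = Poly_Mapping.lookup Q k"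
      by auto
    ultimately show "Poly_Mapping.lookup P k = Poly_Mapping.lookup Q k"
      using eq by metis
  qed
qed

text \<open>With the other coordinates fixed, \<open>P\<close> is a univariate polynomial
  \<open>q\<close> in \<open>t\<close>. One of its coefficients is the value at \<open>x\<close> of
  a non-zero rational polynomial over \<open>I\<close>, so \<open>q\<close> is not zero.\<close>

lemma finite_zeros_in_one_variable:
  assumes x: "algebraically_independent I x" and i: "i \<notin> I"
    and P: "\<And>m. m \<in> Poly_Mapping.keys P \<Longrightarrow> Poly_Mapping.keys m \<subseteq> insert i I" "P \<noteq> 0"
  shows "finite {t. poly_value P (x(i := t)) = 0}"
proof -
  let ?l = "Poly_Mapping.lookup"
  define drop where "drop m = Poly_Mapping.update i (0 :: nat) m" for m :: "'a \<Rightarrow>\<^sub>0 nat"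
  have drop: "?l (drop m) j = (if j = i then 0 else ?l m j)" for m j
    by (simp add: drop_def lookup_update)
  have keys_drop: "Poly_Mapping.keys (drop m) = Poly_Mapping.keys m - {i}" for m
    by (auto simp: in_keys_iff drop split: if_splits)
  have mono: "monomial_value m (x(i := t)) = monomial_value (drop m) x * t ^ ?l m i" for m t
  proof -
    let ?S = "Poly_Mapping.keys m - {i}"
    have "monomial_value m (x(i := t)) = (\<Prod>j\<in>insert i ?S. (x(i := t)) j ^ ?l m j)"
      by (rule monomial_value_superset) auto
    also have "\<dots> = t ^ ?l m i * (\<Prod>j\<in>?S. (x(i := t)) j ^ ?l m j)"
      by (subst prod.insert) auto
    also have "(\<Prod>j\<in>?S. (x(i := t)) j ^ ?l m j) = (\<Prod>j\<in>?S. x j ^ ?l (drop m) j)"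
      by (intro prod.cong) (auto simp: drop)
    also have "\<dots> = monomial_value (drop m) x"
      by (simp add: monomial_value_def keys_drop)
    finally show ?thesis by (simp only: mult.commute)
  qed
  define q where "q = (\<Sum>m\<in>Poly_Mapping.keys P. monom (of_rat (?l P m) * monomial_value (drop m) x) (?l m i))"
  have q: "poly q t = poly_value P (x(i := t))" for t
    by (simp add: q_def poly_value_eq poly_sum poly_monom mono mult.assoc)
  obtain m0 where m0: "m0 \<in> Poly_Mapping.keys P" using P(2) by (metis ex_in_conv keys_eq_empty)
  \<comment> \<open>Any monomial \<open>m0\<close> of \<open>P\<close> will do. \<open>F\<close>
    collects the monomials with the same exponent of \<open>i\<close>; among them only
    \<open>m0\<close> becomes \<open>drop m0\<close>, so its term in \<open>R\<close> cannot
    cancel.\<close>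
  define F where "F = {m \<in> Poly_Mapping.keys P. ?l m i = ?l m0 i}"
  define R where "R = (\<Sum>m\<in>F. Poly_Mapping.single (drop m) (?l P m))"
  have finF: "finite F" by (simp add: F_def)
  have inj: "drop m = drop m0 \<longleftrightarrow> m = m0" if "m \<in> F" for m
  proof
    assume "drop m = drop m0"
    then have "?l m j = ?l m0 j" for j
      using that drop[of m j] drop[of m0 j] by (cases "j = i") (auto simp: F_def)
    then show "m = m0" by (rule poly_mapping_eqI)
  qed simp
  have "?l R (drop m0) = (\<Sum>m\<in>F. if m = m0 then ?l P m else 0)"
    unfolding R_def lookup_sum by (intro sum.cong) (auto simp: lookup_single when_def inj)
  also have "\<dots> = ?l P m0" using finF m0 by (simp add: F_def)
  finally have "R \<noteq> 0" using m0 by (auto simp: in_keys_iff)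
  moreover have "Poly_Mapping.keys m \<subseteq> I" if "m \<in> Poly_Mapping.keys R" for m
  proof -
    have "?l R m \<noteq> 0" using that by (simp add: in_keys_iff)
    then obtain m' where "m' \<in> F" "?l (Poly_Mapping.single (drop m') (?l P m')) m \<noteq> 0"
      unfolding R_def lookup_sum by (meson sum.not_neutral_contains_not_neutral)
    then have "m' \<in> F" "m = drop m'" by (auto simp: lookup_single when_def split: if_splits)
    then show ?thesis using P(1)[of m'] by (auto simp: keys_drop F_def)
  qed
  ultimately have "poly_value R x \<noteq> 0"
    using x unfolding algebraically_independent_def by blast
  moreover have "coeff q (?l m0 i) = poly_value R x"
  proof -
    have "coeff q (?l m0 i) = (\<Sum>m\<in>Poly_Mapping.keys P.
        if ?l m i = ?l m0 i then of_rat (?l P m) * monomial_value (drop m) x else 0)"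
      by (simp add: q_def coeff_sum)
    also have "\<dots> = (\<Sum>m\<in>F. of_rat (?l P m) * monomial_value (drop m) x)"
      unfolding F_def by (simp add: sum.inter_filter)
    finally show ?thesis by (simp add: R_def poly_value_sum poly_value_single)
  qed
  ultimately have "q \<noteq> 0" by auto
  then show ?thesis using poly_roots_finite[of q] by (simp add: q)
qed

text \<open>Coordinates are added one at a time: each of countably many polynomials excludes
  finitely many values of the new coordinate, and the real line is uncountable.\<close>

lemma algebraically_independent_exists:
  assumes "finite (I :: 'i set)"
  shows "\<exists>x. algebraically_independent I x"
  using assms
proof (induction I rule: finite_induct)
  case empty
  have "P = 0" if "\<forall>m\<in>Poly_Mapping.keys P. Poly_Mapping.keys m \<subseteq> {}" "poly_value P (\<lambda>i. 0) = 0"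
    for P :: "('i \<Rightarrow>\<^sub>0 nat) \<Rightarrow>\<^sub>0 rat"
  proof -
    have "Poly_Mapping.keys P \<subseteq> {0}" using that(1) by auto
    then have "poly_value P (\<lambda>i. 0) = (\<Sum>m\<in>{0}. of_rat (Poly_Mapping.lookup P m) * monomial_value m (\<lambda>i. 0))"
      by (intro poly_value_superset) auto
    then have "Poly_Mapping.lookup P 0 = 0" using that(2) by (simp add: monomial_value_def)
    then have "Poly_Mapping.lookup P m = 0" for m
      using \<open>Poly_Mapping.keys P \<subseteq> {0}\<close> by (cases "m = 0") (auto simp: in_keys_iff)
    then show ?thesis by (intro poly_mapping_eqI) simp
  qed
  then show ?case unfolding algebraically_independent_def by blast
next
  case (insert i I)
  then obtain x where x: "algebraically_independent I x" by blast
  define \<P> where "\<P> = {P :: ('i \<Rightarrow>\<^sub>0 nat) \<Rightarrow>\<^sub>0 rat. Poly_Mapping.keys P \<subseteq> {m. Poly_Mapping.keys m \<subseteq> insert i I}}"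
  have "countable \<P>"
    unfolding \<P>_def using insert by (intro countable_poly_mappings) (auto intro: countable_finite)
  moreover have "countable {t. poly_value P (x(i := t)) = 0}" if "P \<in> \<P> - {0}" for P
    using finite_zeros_in_one_variable[OF x insert.hyps(2), of P] that
    by (intro countable_finite) (auto simp: \<P>_def)
  ultimately have "countable (\<Union>P\<in>\<P> - {0}. {t. poly_value P (x(i := t)) = 0})"
    by (intro countable_UN countable_Diff)
  then obtain t where t: "t \<notin> (\<Union>P\<in>\<P> - {0}. {t. poly_value P (x(i := t)) = 0})"
    using uncountable_UNIV_real by (metis UNIV_eq_I)
  then have "algebraically_independent (insert i I) (x(i := t))"
    unfolding algebraically_independent_def \<P>_def by auto
  then show ?case by blast
qed

section \<open>Gluing congruent point sets\<close>

text \<open>With coefficients indexed by \<open>S\<close> instead of by the set of values, repeated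
  vectors count as dependent, so independence includes injectivity of \<open>w\<close>.\<close>

definition independent_family :: "'i set \<Rightarrow> ('i \<Rightarrow> 'b::real_vector) \<Rightarrow> bool" where
  "independent_family S w \<longleftrightarrow> finite S \<and> (\<forall>c. (\<Sum>s\<in>S. c s *\<^sub>R w s) = 0 \<longrightarrow> (\<forall>s\<in>S. c s = 0))"

lemma independent_family_subset:
  assumes "independent_family S w" "T \<subseteq> S"
  shows "independent_family T w"
  unfolding independent_family_def
proof (intro conjI allI impI ballI)
  have S: "finite S" using assms by (simp add: independent_family_def)
  then show "finite T" using assms finite_subset by blast
  fix c s assume c: "(\<Sum>s\<in>T. c s *\<^sub>R w s) = 0" and s: "s \<in> T"
  have "(\<Sum>s\<in>S. (if s \<in> T then c s else 0) *\<^sub>R w s) = (\<Sum>s\<in>T. (if s \<in> T then c s else 0) *\<^sub>R w s)"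
    using S assms(2) by (intro sum.mono_neutral_right) auto
  also have "\<dots> = 0" using c by simp
  finally have "\<forall>s\<in>S. (if s \<in> T then c s else 0) = 0"
    using assms(1) unfolding independent_family_def by (elim conjE) (erule allE, erule mp)
  moreover have "s \<in> S" using s assms(2) by auto
  ultimately show "c s = 0" using s by (metis (full_types))
qed

lemma independent_family_inj:
  assumes "independent_family S w"
  shows "inj_on w S"
proof (rule inj_onI, rule ccontr)
  fix u v assume *: "u \<in> S" "v \<in> S" "w u = w v" "u \<noteq> v"
  have fam: "independent_family {u, v} w" using independent_family_subset[OF assms] * by simp
  have "(\<Sum>s\<in>{u, v}. (if s = u then 1 else - 1) *\<^sub>R w s) = 0" using * by simp
  then have "\<forall>s\<in>{u, v}. (if s = u then 1 else - 1 :: real) = 0"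
    using fam unfolding independent_family_def by (elim conjE) (erule allE, erule mp)
  then show False by auto
qed

lemma independent_family_independent:
  assumes fam: "independent_family S w"
  shows "independent (w ` S)" "card (w ` S) = card S"
proof -
  have inj: "inj_on w S" and fin: "finite S"
    using fam independent_family_inj by (auto simp: independent_family_def)
  show "card (w ` S) = card S" using inj by (rule card_image)
  show "independent (w ` S)"
  proof (rule independent_if_scalars_zero)
    show "finite (w ` S)" using fin by simp
    fix f x assume f: "(\<Sum>x\<in>w ` S. f x *\<^sub>R x) = 0" and x: "x \<in> w ` S"
    have "(\<Sum>s\<in>S. f (w s) *\<^sub>R w s) = 0" using f by (simp add: sum.reindex[OF inj])
    then have "\<forall>s\<in>S. f (w s) = 0"
      using fam[unfolded independent_family_def, THEN conjunct2, rule_format, of "\<lambda>s. f (w s)"] by simp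
    then show "f x = 0" using x by auto
  qed
qed

lemma independent_family_spans:
  fixes w :: "'i \<Rightarrow> 'b::euclidean_space"
  assumes "independent_family S w" "card S = DIM('b)"
  shows "span (w ` S) = UNIV"
  using card_ge_dim_independent[of "w ` S" UNIV] independent_family_independent[OF assms(1)] assms(2)
  by auto

lemma span_image_coefficients:
  assumes "finite S" "inj_on w S" "x \<in> span (w ` S)"
  obtains c where "x = (\<Sum>s\<in>S. c s *\<^sub>R w s)"
proof -
  have "x \<in> range (\<lambda>u. \<Sum>v\<in>w ` S. u v *\<^sub>R v)"
    using assms span_finite[of "w ` S"] by auto
  then obtain u where "x = (\<Sum>v\<in>w ` S. u v *\<^sub>R v)" by auto
  then have "x = (\<Sum>s\<in>S. u (w s) *\<^sub>R w s)" using assms by (simp add: sum.reindex)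
  then show ?thesis by (rule that)
qed

text \<open>This is affine independence of every \<open>DIM('b) + 1\<close> points. It is vacuous if
  \<open>V\<close> has fewer points, so smaller subsets have to be enlarged before it
  applies.\<close>

definition general_position :: "'a set \<Rightarrow> ('a \<Rightarrow> 'b::euclidean_space) \<Rightarrow> bool" where
  "general_position V p \<longleftrightarrow>
     (\<forall>s0\<in>V. \<forall>S \<subseteq> V - {s0}. finite S \<and> card S = DIM('b) \<longrightarrow>
        independent_family S (\<lambda>s. p s - p s0))"

lemma general_position_subset: "general_position V p \<Longrightarrow> X \<subseteq> V \<Longrightarrow> general_position X p"
  unfolding general_position_def by (meson Diff_mono order_refl subset_iff subset_trans)

section \<open>Congruence and residuals\<close>

definition congruent_on :: "'a set \<Rightarrow> ('a \<Rightarrow> 'b::real_inner) \<Rightarrow> ('a \<Rightarrow> 'b) \<Rightarrow> bool" where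
  "congruent_on X p q \<longleftrightarrow> (\<forall>x\<in>X. \<forall>y\<in>X. norm (p x - p y) = norm (q x - q y))"

lemma norm_diff_via_inner:
  fixes a b s :: "'b::real_inner"
  shows "(norm (a - b))\<^sup>2 = (norm (a - s))\<^sup>2 + (norm (b - s))\<^sup>2 - 2 * ((a - s) \<bullet> (b - s))"
  by (simp add: power2_norm_eq_inner inner_diff_left inner_diff_right inner_commute algebra_simps)

lemma congruent_on_inner:
  assumes "congruent_on X p q" "x \<in> X" "y \<in> X" "s \<in> X"
  shows "(p x - p s) \<bullet> (p y - p s) = (q x - q s) \<bullet> (q y - q s)"
  using norm_diff_via_inner[of "p x" "p y" "p s"] norm_diff_via_inner[of "q x" "q y" "q s"] assms
  unfolding congruent_on_def by simp

text \<open>The coefficients \<open>c\<close> are an argument and not computed from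
  \<open>p\<close>, because they are chosen for one realization and reused for another.\<close>

definition residual :: "'a \<Rightarrow> 'a set \<Rightarrow> ('a \<Rightarrow> 'b::real_inner) \<Rightarrow> 'a \<Rightarrow> ('a \<Rightarrow> real) \<Rightarrow> 'b" where
  "residual s0 S p u c = p u - p s0 - (\<Sum>s\<in>S. c s *\<^sub>R (p s - p s0))"

text \<open>Only inner products based at \<open>s0\<close> occur here. Distances determine them, and
  exactly one term pairs \<open>u\<close> with \<open>v\<close>.\<close>

lemma residual_inner:
  "residual s0 S p u c \<bullet> residual s0 S p v d =
     (p u - p s0) \<bullet> (p v - p s0) - (\<Sum>s\<in>S. d s * ((p u - p s0) \<bullet> (p s - p s0)))
     - (\<Sum>s\<in>S. c s * ((p s - p s0) \<bullet> (p v - p s0)))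
     + (\<Sum>s\<in>S. \<Sum>t\<in>S. c s * (d t * ((p s - p s0) \<bullet> (p t - p s0))))"
proof -
  define a where "a = p u - p s0"
  define b where "b = p v - p s0"
  define w where "w s = p s - p s0" for s
  have "(a - (\<Sum>s\<in>S. c s *\<^sub>R w s)) \<bullet> (b - (\<Sum>s\<in>S. d s *\<^sub>R w s)) =
      a \<bullet> b - a \<bullet> (\<Sum>s\<in>S. d s *\<^sub>R w s) - (\<Sum>s\<in>S. c s *\<^sub>R w s) \<bullet> b
      + (\<Sum>s\<in>S. c s *\<^sub>R w s) \<bullet> (\<Sum>s\<in>S. d s *\<^sub>R w s)"
    by (simp add: inner_diff_left inner_diff_right)
  also have "a \<bullet> (\<Sum>s\<in>S. d s *\<^sub>R w s) = (\<Sum>s\<in>S. d s * (a \<bullet> w s))"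
    by (simp add: inner_sum_right)
  also have "(\<Sum>s\<in>S. c s *\<^sub>R w s) \<bullet> b = (\<Sum>s\<in>S. c s * (w s \<bullet> b))"
    by (simp add: inner_sum_left)
  also have "(\<Sum>s\<in>S. c s *\<^sub>R w s) \<bullet> (\<Sum>s\<in>S. d s *\<^sub>R w s) =
      (\<Sum>s\<in>S. \<Sum>t\<in>S. c s * (d t * (w s \<bullet> w t)))"
    unfolding inner_sum_left by (simp add: inner_sum_right sum_distrib_left mult.left_commute)
  finally show ?thesis by (simp add: residual_def a_def b_def w_def)
qed

lemma congruent_on_residual_inner:
  assumes "congruent_on X p q" "u \<in> X" "v \<in> X" "s0 \<in> X" "S \<subseteq> X"
  shows "residual s0 S p u c \<bullet> residual s0 S p v d = residual s0 S q u c \<bullet> residual s0 S q v d"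
proof -
  have *: "(p x - p s0) \<bullet> (p y - p s0) = (q x - q s0) \<bullet> (q y - q s0)" if "x \<in> X" "y \<in> X" for x y
    using congruent_on_inner[OF assms(1) that assms(4)] .
  have "\<And>s. s \<in> S \<Longrightarrow> s \<in> X" using assms by auto
  then show ?thesis unfolding residual_inner using assms by (simp add: * cong: sum.cong)
qed

text \<open>In the expansion of \<open>res\<close>, every product except that of \<open>u\<close>
  and \<open>v\<close> lies within \<open>X\<close> or within \<open>Y\<close>, where
  \<open>p\<close> and \<open>q\<close> agree. So they agree in the remaining one too.\<close>

lemma glue_norm:
  assumes X: "congruent_on X p q" "congruent_on Y p q"
    and uv: "u \<in> X" "v \<in> Y" and S: "s0 \<in> X \<inter> Y" "S \<subseteq> X \<inter> Y"
    and res: "residual s0 S p u c \<bullet> residual s0 S p v d = residual s0 S q u c \<bullet> residual s0 S q v d"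
  shows "norm (p u - p v) = norm (q u - q v)"
proof -
  have S': "\<And>s. s \<in> S \<Longrightarrow> s \<in> X" "\<And>s. s \<in> S \<Longrightarrow> s \<in> Y" "s0 \<in> X" "s0 \<in> Y" using S by auto
  have X': "(p x - p s0) \<bullet> (p y - p s0) = (q x - q s0) \<bullet> (q y - q s0)" if "x \<in> X" "y \<in> X" for x y
    using congruent_on_inner[OF X(1) that] S by simp
  have Y': "(p x - p s0) \<bullet> (p y - p s0) = (q x - q s0) \<bullet> (q y - q s0)" if "x \<in> Y" "y \<in> Y" for x y
    using congruent_on_inner[OF X(2) that] S by simp
  have "(p u - p s0) \<bullet> (p v - p s0) = (q u - q s0) \<bullet> (q v - q s0)"
    using res unfolding residual_inner using S' uv by (simp add: X' Y' cong: sum.cong)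
  moreover have "norm (p u - p s0) = norm (q u - q s0)" "norm (p v - p s0) = norm (q v - q s0)"
    using X uv S unfolding congruent_on_def by auto
  ultimately have "(norm (p u - p v))\<^sup>2 = (norm (q u - q v))\<^sup>2"
    using norm_diff_via_inner[of "p u" "p v" "p s0"] norm_diff_via_inner[of "q u" "q v" "q s0"] by simp
  then show ?thesis by simp
qed

lemma congruent_on_Un:
  assumes X: "congruent_on X p q" "congruent_on Y p q"
    and *: "\<And>u v. u \<in> X \<Longrightarrow> v \<in> Y \<Longrightarrow> norm (p u - p v) = norm (q u - q v)"
  shows "congruent_on (X \<union> Y) p q"
  using assms unfolding congruent_on_def by (metis Un_iff norm_minus_commute)

text \<open>The differences of the common points span the space, so the residual of \<open>u\<close>
  can be made zero for \<open>p\<close>. Its norm is an invariant of \<open>X\<close>, hence it is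
  zero for \<open>q\<close> as well, and both residual products vanish.\<close>

lemma glue_congruent:
  fixes p q :: "'a \<Rightarrow> 'b::euclidean_space"
  assumes gp: "general_position (X \<union> Y) p" and X: "congruent_on X p q" "congruent_on Y p q"
    and card: "DIM('b) + 1 \<le> card (X \<inter> Y)"
  shows "congruent_on (X \<union> Y) p q"
proof (rule congruent_on_Un[OF X])
  fix u v assume uv: "u \<in> X" "v \<in> Y"
  obtain T where T: "T \<subseteq> X \<inter> Y" "card T = DIM('b) + 1" "finite T"
    using obtain_subset_with_card_n[OF card] by metis
  then have "T \<noteq> {}" by auto
  then obtain s0 where s0: "s0 \<in> T" by auto
  define S where "S = T - {s0}"
  have S: "S \<subseteq> X \<inter> Y" "finite S" "card S = DIM('b)" "s0 \<in> X \<inter> Y" "s0 \<notin> S"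
    using T s0 by (auto simp: S_def)
  have fam: "independent_family S (\<lambda>s. p s - p s0)"
    using gp S unfolding general_position_def by blast
  obtain c where c: "p u - p s0 = (\<Sum>s\<in>S. c s *\<^sub>R (p s - p s0))"
    using span_image_coefficients[OF S(2) independent_family_inj[OF fam], of "p u - p s0"]
      independent_family_spans[OF fam S(3)] by auto
  then have zero: "residual s0 S p u c = 0" by (simp add: residual_def)
  have "residual s0 S p u c \<bullet> residual s0 S p u c = residual s0 S q u c \<bullet> residual s0 S q u c"
    using congruent_on_residual_inner[OF X(1)] uv S by simp
  then have "residual s0 S q u c = 0" using zero by simp
  then show "norm (p u - p v) = norm (q u - q v)"
    using glue_norm[OF X uv S(4,1), of c "\<lambda>_. 0"] zero by simp
qed

section \<open>Gluing close to a given realization\<close>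

lemma orthogonal_complement_collinear:
  fixes x y :: "'b::euclidean_space"
  assumes B: "independent B" "card B + 1 = DIM('b)"
    and x: "\<And>b. b \<in> B \<Longrightarrow> x \<bullet> b = 0" and y: "\<And>b. b \<in> B \<Longrightarrow> y \<bullet> b = 0"
  shows "(x \<bullet> y)\<^sup>2 = (x \<bullet> x) * (y \<bullet> y)"
proof (cases "x = 0")
  case False
  have orth: "z \<bullet> b = 0" if "b \<in> span B" "\<And>b. b \<in> B \<Longrightarrow> z \<bullet> b = 0" for z b
    using orthogonal_to_span[of b B z] that by (simp add: orthogonal_def)
  have "x \<notin> span B" using orth[of x x] x False by auto
  then have "independent (insert x B)" using B(1) by (rule independent_insertI)
  moreover have "x \<notin> B" using \<open>x \<notin> span B\<close> span_base by blast
  moreover have "finite B" using B(1) by (rule independent_imp_finite)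
  \<comment> \<open>\<open>x\<close> completes \<open>B\<close> to a basis, so \<open>y\<close> is a
    multiple of \<open>x\<close> up to an element of \<open>span B\<close>, which orthogonality
    removes. The claim is the equality case of Cauchy-Schwarz, squared so that the sign stays
    open.\<close>
  ultimately have "y \<in> span (insert x B)"
    using card_ge_dim_independent[of "insert x B" UNIV] B(2) by auto
  then obtain k where k: "y - k *\<^sub>R x \<in> span B" using span_breakdown_eq by metis
  have "(y - k *\<^sub>R x) \<bullet> (y - k *\<^sub>R x) = 0"
    by (rule orth[OF k]) (simp add: inner_diff_left x y)
  then have "y = k *\<^sub>R x" by simp
  then show ?thesis by (simp add: power2_eq_square)
qed simp

lemma orthogonal_residual_exists:
  fixes p :: "'a \<Rightarrow> 'b::euclidean_space"
  assumes fam: "independent_family S (\<lambda>s. p s - p s0)"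
  obtains c where "\<And>s. s \<in> S \<Longrightarrow> residual s0 S p u c \<bullet> (p s - p s0) = 0"
proof -
  obtain y z where yz: "y \<in> span ((\<lambda>s. p s - p s0) ` S)"
    "\<And>w. w \<in> span ((\<lambda>s. p s - p s0) ` S) \<Longrightarrow> orthogonal z w" "p u - p s0 = y + z"
    using orthogonal_subspace_decomp_exists[of "(\<lambda>s. p s - p s0) ` S" "p u - p s0"] by metis
  obtain c where "y = (\<Sum>s\<in>S. c s *\<^sub>R (p s - p s0))"
    using span_image_coefficients[OF _ independent_family_inj[OF fam] yz(1)] fam
    by (auto simp: independent_family_def)
  then have "residual s0 S p u c = z" using yz(3) by (simp add: residual_def)
  then show ?thesis using yz(2) that[of c] by (simp add: orthogonal_def span_base)
qed

text \<open>A reference vector is itself a residual, so orthogonality to it is a residual product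
  and carries over from \<open>p\<close> to a congruent realization.\<close>

lemma residual_generator: "residual s0 S p s (\<lambda>_. 0) = p s - p s0"
  by (simp add: residual_def)

text \<open>The residuals of \<open>u\<close> and \<open>v\<close> are orthogonal to a hyperplane direction, hence collinear, and
  their lengths are determined. So their inner product is determined up to sign, and the sign
  cannot jump along a convergent sequence.\<close>

lemma glue_eventually_norm:
  fixes p :: "'a \<Rightarrow> 'b::euclidean_space" and q :: "nat \<Rightarrow> 'a \<Rightarrow> 'b"
  assumes fam: "independent_family S (\<lambda>s. p s - p s0)" and S: "card S + 1 = DIM('b)" "S \<subseteq> X \<inter> Y" "s0 \<in> X \<inter> Y"
    and lim: "\<And>x. x \<in> X \<union> Y \<Longrightarrow> (\<lambda>n. q n x) \<longlonglongrightarrow> p x"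
    and cong: "\<forall>\<^sub>F n in sequentially. congruent_on X p (q n)" "\<forall>\<^sub>F n in sequentially. congruent_on Y p (q n)"
    and uv: "u \<in> X" "v \<in> Y"
  shows "\<forall>\<^sub>F n in sequentially. norm (p u - p v) = norm (q n u - q n v)"
proof -
  obtain c where c: "\<And>s. s \<in> S \<Longrightarrow> residual s0 S p u c \<bullet> (p s - p s0) = 0"
    using orthogonal_residual_exists[OF fam] by metis
  obtain d where d: "\<And>s. s \<in> S \<Longrightarrow> residual s0 S p v d \<bullet> (p s - p s0) = 0"
    using orthogonal_residual_exists[OF fam] by metis
  have fin: "finite S" using fam by (simp add: independent_family_def)
  \<comment> \<open>\<open>c\<close> and \<open>d\<close> come from orthogonal projection at
    \<open>p\<close> and are kept fixed for all \<open>q n\<close>; this makes \<open>F\<close>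
    continuous along the sequence.\<close>
  define F where "F q = residual s0 S q u c \<bullet> residual s0 S q v d" for q :: "'a \<Rightarrow> 'b"
  have limS: "(\<lambda>n. q n s) \<longlonglongrightarrow> p s" if "s \<in> S" for s using lim S that by auto
  have "(\<lambda>n. F (q n)) \<longlonglongrightarrow> F p"
    unfolding F_def residual_def using S uv by (intro tendsto_intros lim limS) auto
  moreover have square: "(F (q n))\<^sup>2 = (F p)\<^sup>2"
    if X: "congruent_on X p (q n)" and Y: "congruent_on Y p (q n)" for n
  proof -
    let ?w = "\<lambda>s. q n s - q n s0"
    have SX: "S \<subseteq> X" "s0 \<in> X" "S \<subseteq> Y" "s0 \<in> Y" using S by auto
    note rX = congruent_on_residual_inner[OF X _ _ SX(2,1)]
    note rY = congruent_on_residual_inner[OF Y _ _ SX(4,3)]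
    have u0: "residual s0 S (q n) u c \<bullet> ?w s = 0" if "s \<in> S" for s
      using rX[of u s c "\<lambda>_. 0"] c[OF that] that uv SX by (auto simp: residual_generator)
    have v0: "residual s0 S (q n) v d \<bullet> ?w s = 0" if "s \<in> S" for s
      using rY[of v s d "\<lambda>_. 0"] d[OF that] that uv SX by (auto simp: residual_generator)
    have fam': "independent_family S ?w"
      unfolding independent_family_def
    proof (intro conjI fin allI impI)
      fix c' assume c': "(\<Sum>s\<in>S. c' s *\<^sub>R ?w s) = 0"
      \<comment> \<open>Up to sign, a linear combination of the reference vectors is a residual of
        \<open>s0\<close>, whose norm is preserved by congruence; so a dependence at
        \<open>q n\<close> is one at \<open>p\<close>.\<close>
      have "residual s0 S (q n) s0 c' = 0" using c' by (simp add: residual_def)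
      then have "residual s0 S p s0 c' = 0"
        using rX[of s0 s0 c' c'] SX by simp
      then have "(\<Sum>s\<in>S. c' s *\<^sub>R (p s - p s0)) = 0" by (simp add: residual_def)
      then show "\<forall>s\<in>S. c' s = 0" using fam unfolding independent_family_def by blast
    qed
    have col: "(x \<bullet> y)\<^sup>2 = (x \<bullet> x) * (y \<bullet> y)"
      if "independent_family S w" "\<And>s. s \<in> S \<Longrightarrow> x \<bullet> w s = 0" "\<And>s. s \<in> S \<Longrightarrow> y \<bullet> w s = 0"
      for w :: "'a \<Rightarrow> 'b" and x y
      using orthogonal_complement_collinear[OF independent_family_independent(1)[OF that(1)], of x y]
        independent_family_independent(2)[OF that(1)] that(2,3) S(1) by auto
    have "(F (q n))\<^sup>2 = (residual s0 S (q n) u c \<bullet> residual s0 S (q n) u c) *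
        (residual s0 S (q n) v d \<bullet> residual s0 S (q n) v d)"
      unfolding F_def by (rule col[OF fam' u0 v0])
    also have "\<dots> = (residual s0 S p u c \<bullet> residual s0 S p u c) * (residual s0 S p v d \<bullet> residual s0 S p v d)"
      using rX[of u u c c] rY[of v v d d] uv by simp
    also have "\<dots> = (F p)\<^sup>2"
      unfolding F_def by (rule col[OF fam c d, symmetric])
    finally show ?thesis .
  qed
  have ev: "\<forall>\<^sub>F n in sequentially. F (q n) = F p"
  proof (cases "F p = 0")
    case True
    from cong show ?thesis
      by eventually_elim (use square True in simp)
  next
    case False
    \<comment> \<open>The wrong value \<open>- F p\<close> has distance
      \<open>2 * \<bar>F p\<bar>\<close> from \<open>F p\<close>, so this radius excludes
      it.\<close>
    then have "\<forall>\<^sub>F n in sequentially. dist (F (q n)) (F p) < \<bar>F p\<bar>"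
      using \<open>(\<lambda>n. F (q n)) \<longlonglongrightarrow> F p\<close> by (intro tendstoD) auto
    with cong show ?thesis
    proof eventually_elim
      case (elim n)
      then have "F (q n) = F p \<or> F (q n) = - F p"
        using square by (simp add: power2_eq_iff)
      then show ?case using elim by (auto simp: dist_real_def)
    qed
  qed
  from cong ev show ?thesis
  proof eventually_elim
    case (elim n)
    show ?case
      by (rule glue_norm[OF elim(1,2) uv S(3,2) elim(3)[unfolded F_def, symmetric]])
  qed
qed

lemma glue_eventually_congruent:
  fixes p :: "'a \<Rightarrow> 'b::euclidean_space" and q :: "nat \<Rightarrow> 'a \<Rightarrow> 'b"
  assumes gp: "general_position (X \<union> Y) p" and fin: "finite X" "finite Y"
    and card: "DIM('b) \<le> card (X \<inter> Y)" "X \<union> Y \<noteq> X \<inter> Y"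
    and lim: "\<And>x. x \<in> X \<union> Y \<Longrightarrow> (\<lambda>n. q n x) \<longlonglongrightarrow> p x"
    and cong: "\<forall>\<^sub>F n in sequentially. congruent_on X p (q n)" "\<forall>\<^sub>F n in sequentially. congruent_on Y p (q n)"
  shows "\<forall>\<^sub>F n in sequentially. congruent_on (X \<union> Y) p (q n)"
proof -
  obtain T where T: "T \<subseteq> X \<inter> Y" "card T = DIM('b)" "finite T"
    using obtain_subset_with_card_n[OF card(1)] by metis
  then have "T \<noteq> {}" by auto
  then obtain s0 where s0: "s0 \<in> T" by auto
  \<comment> \<open>The common points alone may be too few for general position to say anything. A
    point \<open>z\<close> outside the intersection completes \<open>S\<close>, and independence is
    then inherited by \<open>S\<close>.\<close>
  obtain z where z: "z \<in> X \<union> Y" "z \<notin> X \<inter> Y" using card(2) by auto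
  define S where "S = T - {s0}"
  have S: "card S + 1 = DIM('b)" "S \<subseteq> X \<inter> Y" "s0 \<in> X \<inter> Y"
    using T s0 by (auto simp: S_def card_gt_0_iff)
  have "insert z S \<subseteq> X \<union> Y - {s0}" using z T s0 by (auto simp: S_def)
  moreover have "z \<notin> S" using z S by auto
  then have "card (insert z S) = DIM('b)" using S T by (simp add: S_def)
  moreover have "finite (insert z S)" using T by (simp add: S_def)
  ultimately have "independent_family (insert z S) (\<lambda>s. p s - p s0)"
    using gp S unfolding general_position_def by blast
  then have fam: "independent_family S (\<lambda>s. p s - p s0)"
    by (rule independent_family_subset) auto
  have "\<forall>\<^sub>F n in sequentially. \<forall>u\<in>X. \<forall>v\<in>Y. norm (p u - p v) = norm (q n u - q n v)"
    using glue_eventually_norm[OF fam S lim cong] fin by (simp add: eventually_ball_finite_distrib)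
  with cong show ?thesis
    by eventually_elim (auto intro: congruent_on_Un)
qed

section \<open>Reflections in a hyperplane\<close>

lemma reflection_preserves_norm:
  fixes a s x y :: "'b::real_inner"
  assumes "a \<noteq> 0"
  defines "r \<equiv> \<lambda>z. z - (2 * (a \<bullet> (z - s)) / (a \<bullet> a)) *\<^sub>R a"
  shows "norm (r x - r y) = norm (x - y)"
    and "(norm (r x - y))\<^sup>2 = (norm (x - y))\<^sup>2 + 4 * (a \<bullet> (x - s)) * (a \<bullet> (y - s)) / (a \<bullet> a)"
proof -
  have a: "a \<bullet> a \<noteq> 0" using assms by simp
  \<comment> \<open>This expansion serves both claims. If both points are reflected, the terms in
    \<open>k\<close> cancel; if only \<open>x\<close> is, they leave a product that vanishes only
    when \<open>x\<close> or \<open>y\<close> lies on the mirror.\<close>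
  have gen: "(norm (v - k *\<^sub>R a))\<^sup>2 = (norm v)\<^sup>2 - 2 * k * (a \<bullet> v) + k\<^sup>2 * (a \<bullet> a)" for v k
    unfolding power2_norm_eq_inner
    by (simp add: inner_diff_left inner_diff_right inner_commute power2_eq_square algebra_simps)
  have "r x - r y = (x - y) - (2 * (a \<bullet> (x - y)) / (a \<bullet> a)) *\<^sub>R a"
    by (simp add: r_def algebra_simps inner_diff_right diff_divide_distrib add_divide_distrib)
  then have "(norm (r x - r y))\<^sup>2 = (norm (x - y))\<^sup>2"
    using a by (simp only: gen) (simp add: power2_eq_square)
  then show "norm (r x - r y) = norm (x - y)" by simp
  have "r x - y = (x - y) - (2 * (a \<bullet> (x - s)) / (a \<bullet> a)) *\<^sub>R a"
    by (simp add: r_def)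
  moreover have "a \<bullet> (x - y) = a \<bullet> (x - s) - a \<bullet> (y - s)"
    by (simp add: inner_diff_right)
  ultimately show "(norm (r x - y))\<^sup>2 = (norm (x - y))\<^sup>2 + 4 * (a \<bullet> (x - s)) * (a \<bullet> (y - s)) / (a \<bullet> a)"
    using a by (simp only: gen) (simp add: power2_eq_square field_simps)
qed

text \<open>The differences within \<open>S\<close> span less than the whole space, which leaves a
  normal \<open>a\<close>. A further point on the mirror would give \<open>DIM('b)\<close>
  independent differences, all orthogonal to \<open>a\<close>.\<close>

lemma separating_normal_exists:
  fixes p :: "'a \<Rightarrow> 'b::euclidean_space"
  assumes gp: "general_position V p" and S: "S \<subseteq> V" "finite S" "card S = DIM('b)" "s0 \<in> S"
  obtains a where "a \<noteq> 0" "\<And>s. s \<in> S \<Longrightarrow> a \<bullet> (p s - p s0) = 0"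
    "\<And>x. x \<in> V - S \<Longrightarrow> a \<bullet> (p x - p s0) \<noteq> 0"
proof -
  let ?w = "\<lambda>s. p s - p s0"
  let ?S = "S - {s0}"
  have "card ?S < DIM('b)" using S by (metis card_Diff1_less)
  moreover have "dim (?w ` ?S) \<le> card ?S"
    using dim_le_card'[of "?w ` ?S"] card_image_le[of ?S ?w] S by auto
  ultimately have "dim (?w ` ?S) < DIM('b)" by simp
  then obtain a where a: "a \<noteq> 0" "\<And>y. y \<in> span (?w ` ?S) \<Longrightarrow> orthogonal a y"
    by (rule orthogonal_to_subspace_exists) blast
  have orth: "a \<bullet> ?w s = 0" if "s \<in> S" for s
  proof (cases "s = s0")
    case False
    then have "?w s \<in> span (?w ` ?S)" using that by (intro span_base) auto
    then show ?thesis using a(2) by (simp add: orthogonal_def)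
  qed simp
  have "a \<bullet> ?w x \<noteq> 0" if x: "x \<in> V - S" for x
  proof
    assume 0: "a \<bullet> ?w x = 0"
    have "insert x ?S \<subseteq> V - {s0}" "finite (insert x ?S)" "card (insert x ?S) = DIM('b)"
      using x S by (auto simp: card_gt_0_iff)
    moreover have "s0 \<in> V" using S by auto
    ultimately have "span (?w ` insert x ?S) = UNIV"
      using gp independent_family_spans unfolding general_position_def by blast
    moreover have "orthogonal a y" if "y \<in> ?w ` insert x ?S" for y
      using that 0 orth by (auto simp: orthogonal_def)
    ultimately have "orthogonal a a"
      using orthogonal_to_span[of a "?w ` insert x ?S" a] by simp
    then show False using a(1) by (simp add: orthogonal_def)
  qed
  then show ?thesis using that a(1) orth by blast
qed

section \<open>Gluing constructions and joined graphs\<close>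

text \<open>Each step refers only to earlier entries of its own list, so concatenation shifts all
  its indices alike. The new last step glues the final entries of the two lists.\<close>

lemma gluing_construction_union:
  fixes H :: "'a pair_pre_digraph"
  assumes 1: "globally_rigid_gluing_construction TYPE('d::finite) H1 Gs1"
    and 2: "globally_rigid_gluing_construction TYPE('d) H2 Gs2"
    and H: "pair_graph H" "card (pverts H) \<ge> CARD('d) + 1"
      "with_proj H = Digraph_Component.union (with_proj H1) (with_proj H2)"
      "pverts H1 \<noteq> pverts H" "pverts H2 \<noteq> pverts H"
      "card (pverts H1 \<inter> pverts H2) \<ge> CARD('d)"
  shows "globally_rigid_gluing_construction TYPE('d) H (Gs1 @ Gs2 @ [H])"
  unfolding globally_rigid_gluing_construction_def
proof (intro conjI allI impI)
  define glued where "glued Gs i \<longleftrightarrow>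
      (\<exists>j l. j < l \<and> l < i \<and>
          with_proj (Gs ! i) = Digraph_Component.union (with_proj (Gs ! j)) (with_proj (Gs ! l)) \<and>
          pverts (Gs ! j) \<noteq> pverts (Gs ! i) \<and> pverts (Gs ! l) \<noteq> pverts (Gs ! i) \<and>
          card (pverts (Gs ! j) \<inter> pverts (Gs ! l)) \<ge> CARD('d))"
    for i and Gs :: "'a pair_pre_digraph list"
  define step where "step Gs i \<longleftrightarrow>
      (card (pverts (Gs ! i)) \<ge> CARD('d) + 1 \<and> globally_rigid TYPE('d) (Gs ! i)) \<or> glued Gs i"
    for i and Gs :: "'a pair_pre_digraph list"
  have ne: "Gs1 \<noteq> []" "Gs2 \<noteq> []" and last: "last Gs1 = H1" "last Gs2 = H2"
    and pg: "\<forall>K\<in>set Gs1 \<union> set Gs2. pair_graph K"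
    and steps: "\<And>i. i < length Gs1 \<Longrightarrow> step Gs1 i" "\<And>i. i < length Gs2 \<Longrightarrow> step Gs2 i"
    using 1 2 unfolding globally_rigid_gluing_construction_def step_def glued_def by auto
  have shift: "step (A @ Gs @ B) (length A + i)" if "step Gs i" "i < length Gs"
    for A Gs B :: "'a pair_pre_digraph list" and i
  proof -
    have nth: "(A @ Gs @ B) ! (length A + j) = Gs ! j" if "j < length Gs" for j
      using that by (simp add: nth_append)
    show ?thesis
    proof (cases "card (pverts (Gs ! i)) \<ge> CARD('d) + 1 \<and> globally_rigid TYPE('d) (Gs ! i)")
      case True
      then show ?thesis using nth[OF that(2)] unfolding step_def by simp
    next
      case False
      then have "glued Gs i" using that(1) unfolding step_def by argo
      then obtain j l where *: "j < l" "l < i"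
        "with_proj (Gs ! i) = Digraph_Component.union (with_proj (Gs ! j)) (with_proj (Gs ! l))"
        "pverts (Gs ! j) \<noteq> pverts (Gs ! i)" "pverts (Gs ! l) \<noteq> pverts (Gs ! i)"
        "CARD('d) \<le> card (pverts (Gs ! j) \<inter> pverts (Gs ! l))"
        unfolding glued_def by (elim exE conjE) (rule that)
      have jl: "j < length Gs" "l < length Gs" using * that by auto
      show ?thesis
        unfolding step_def glued_def nth[OF that(2)]
        by (intro disjI2 exI[of _ "length A + j"] exI[of _ "length A + l"])
           (unfold nth[OF jl(1)] nth[OF jl(2)], use * in simp)
    qed
  qed
  let ?Gs = "Gs1 @ Gs2 @ [H]"
  fix i assume i: "i < length ?Gs"
  have "step ?Gs i"
  proof -
    consider "i < length Gs1" | k where "i = length Gs1 + k" "k < length Gs2" | "i = length Gs1 + length Gs2"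
      using i by (metis add.commute add_diff_inverse_nat length_append length_append_singleton
          less_Suc_eq nat_add_left_cancel_less add_Suc_right)
    then show ?thesis
    proof cases
      case 1
      then show ?thesis using shift[OF steps(1) , of i "[]" "Gs2 @ [H]"] by simp
    next
      case 2
      then show ?thesis using shift[OF steps(2), of k Gs1 "[H]"] by simp
    next
      case 3
      have "?Gs ! i = H" using 3 by (simp add: nth_append)
      moreover have "?Gs ! (length Gs1 - 1) = H1"
        using ne last by (simp add: nth_append last_conv_nth)
      moreover have "?Gs ! (length Gs1 + (length Gs2 - 1)) = H2"
        using ne last by (simp add: nth_append last_conv_nth)
      moreover have "length Gs1 - 1 < length Gs1 + (length Gs2 - 1)"
        "length Gs1 + (length Gs2 - 1) < i" using 3 ne by (auto simp: neq_Nil_conv)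
      ultimately show ?thesis
        unfolding step_def glued_def using H
        by (intro disjI2 exI[of _ "length Gs1 - 1"] exI[of _ "length Gs1 + (length Gs2 - 1)"]) simp
    qed
  qed
  then show "(card (pverts (?Gs ! i)) \<ge> CARD('d) + 1 \<and> globally_rigid TYPE('d) (?Gs ! i)) \<or>
       (\<exists>j l. j < l \<and> l < i \<and>
          with_proj (?Gs ! i) = Digraph_Component.union (with_proj (?Gs ! j)) (with_proj (?Gs ! l)) \<and>
          pverts (?Gs ! j) \<noteq> pverts (?Gs ! i) \<and> pverts (?Gs ! l) \<noteq> pverts (?Gs ! i) \<and>
          card (pverts (?Gs ! j) \<inter> pverts (?Gs ! l)) \<ge> CARD('d))"
    unfolding step_def glued_def .
qed (use H 1 2 in \<open>auto simp: globally_rigid_gluing_construction_def\<close>)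

lemma generic_realization_general_position:
  fixes p :: "'a \<Rightarrow> real ^ 'd"
  assumes "generic_realization G p"
  shows "general_position (pverts G) p"
  unfolding general_position_def
proof (intro ballI allI impI)
  fix s0 S assume *: "s0 \<in> pverts G" "S \<subseteq> pverts G - {s0}" "finite S \<and> card S = DIM(real ^ 'd)"
  then have "S \<subseteq> pverts G" "s0 \<notin> S" "finite S" "card S = CARD('d)" by auto
  then show "independent_family S (\<lambda>s. p s - p s0)"
    unfolding independent_family_def
    using algebraically_independent_points[OF assms[unfolded generic_realization_def] *(1)] by metis
qed

text \<open>Refuting \<open>globally_linked\<close> takes an actual generic realization; without one
  the property would hold vacuously.\<close>

lemma generic_realization_exists:
  assumes "finite (pverts G)"
  shows "\<exists>p :: 'a \<Rightarrow> real ^ 'd. generic_realization (G :: 'a pair_pre_digraph) p"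
proof -
  obtain x where x: "algebraically_independent (pverts G \<times> (UNIV :: 'd set)) x"
    using algebraically_independent_exists[of "pverts G \<times> (UNIV :: 'd set)"] assms by auto
  define p :: "'a \<Rightarrow> real ^ 'd" where "p v = (\<chi> k. x (v, k))" for v
  have "(\<lambda>(v, k). p v $ k) = x" by (auto simp: p_def)
  then show ?thesis using x unfolding generic_realization_def by (intro exI[of _ p]) simp
qed

section \<open>Rigidity of chordal graphs by splitting\<close>

context chordal_graph
begin

definition induced :: "'a set \<Rightarrow> 'a pair_pre_digraph" where
  "induced X = \<lparr>pverts = X, parcs = parcs G \<inter> X \<times> X\<rparr>"

lemma induced_simps [simp]:
  "pverts (induced X) = X" "parcs (induced X) = parcs G \<inter> X \<times> X"
  by (simp_all add: induced_def)

lemma induced_pverts: "induced (pverts G) = G"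
proof -
  have "parcs G \<inter> pverts G \<times> pverts G = parcs G"
    using in_arcsD1 in_arcsD2 by auto
  then show ?thesis by (simp add: induced_def)
qed

lemma pair_graph_induced:
  assumes "X \<subseteq> pverts G"
  shows "pair_graph (induced X)"
proof
  show "finite (pverts (induced X))" "finite (parcs (induced X))"
    using finite_subset[OF assms pair_finite_verts] pair_finite_arcs by auto
  show "symmetric (with_proj (induced X))"
    unfolding symmetric_def using adj_sym by (auto intro!: symI)
qed (use adj_irrefl in auto)

text \<open>No arc joins \<open>X1 - X2\<close> to \<open>X2 - X1\<close>, so every arc inside
  \<open>X\<close> lies inside one of the parts.\<close>

lemma induced_separation:
  assumes "separation X X1 X2"
  shows "with_proj (induced X) = Digraph_Component.union (with_proj (induced X1)) (with_proj (induced X2))"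
proof -
  have "X = X1 \<union> X2" using assms by (simp add: separation_def)
  moreover have "parcs G \<inter> X \<times> X = (parcs G \<inter> X1 \<times> X1) \<union> (parcs G \<inter> X2 \<times> X2)"
    using assms adj_sym unfolding separation_def by blast
  ultimately show ?thesis
    by (simp add: Digraph_Component.union_def with_proj_def)
qed

text \<open>Base case of the recursions: in a clique every distance is an edge length.\<close>

lemma clique_congruent:
  assumes "clique X" "equivalent_realizations (induced X) p q"
  shows "congruent_on X p q"
  unfolding congruent_on_def
proof (intro ballI)
  fix x y assume "x \<in> X" "y \<in> X"
  then show "norm (p x - p y) = norm (q x - q y)"
    using assms by (cases "x = y") (auto simp: clique_def equivalent_realizations_def)
qed

lemma equivalent_realizations_subset:
  "equivalent_realizations (induced X) p q \<Longrightarrow> Y \<subseteq> X \<Longrightarrow> equivalent_realizations (induced Y) p q"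
  unfolding equivalent_realizations_def by auto

lemma gluing_construction_exists:
  assumes "X \<subseteq> pverts G" "well_linked CARD('d::finite) X" "CARD('d) + 1 \<le> card X"
  shows "\<exists>Gs. globally_rigid_gluing_construction TYPE('d) (induced X) Gs"
proof -
  have "finite X" using assms pair_finite_verts finite_subset by blast
  then show ?thesis using assms
  proof (induction X rule: finite_psubset_induct)
    case (psubset X)
    show ?case
    proof (cases "clique X")
      case True
      then have "globally_rigid TYPE('d) (induced X)"
        unfolding globally_rigid_def congruent_realizations_def
        by (simp add: clique_congruent[unfolded congruent_on_def])
      then have "globally_rigid_gluing_construction TYPE('d) (induced X) [induced X]"
        using psubset.prems pair_graph_induced by (simp add: globally_rigid_gluing_construction_def)
      then show ?thesis by blast
    next
      case False
      obtain X1 X2 where *: "separation X X1 X2" "X1 \<subset> X" "X2 \<subset> X" "CARD('d) \<le> card (X1 \<inter> X2)"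
        "well_linked CARD('d) X1" "well_linked CARD('d) X2"
        using well_linked_split[OF psubset.prems(1,2) False] by metis
      have fin: "finite X1" "finite X2" using * psubset.hyps by (auto intro: finite_subset)
      have "X = X1 \<union> X2" using * by (simp add: separation_def)
      \<comment> \<open>Each part properly contains a separator with at least
        \<open>CARD('d)\<close> vertices, which yields the size bound needed for both recursive
        calls.\<close>
      then have "X1 \<inter> X2 \<subset> X1" "X1 \<inter> X2 \<subset> X2" using * by auto
      then have "card (X1 \<inter> X2) < card X1" "card (X1 \<inter> X2) < card X2"
        using fin by (auto intro: psubset_card_mono)
      then have card: "CARD('d) + 1 \<le> card X1" "CARD('d) + 1 \<le> card X2" using * by auto
      have V: "X1 \<subseteq> pverts G" "X2 \<subseteq> pverts G" using * psubset.prems(1) by auto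
      obtain Gs1 where 1: "globally_rigid_gluing_construction TYPE('d) (induced X1) Gs1"
        using psubset.IH[OF *(2) V(1) *(5) card(1)] by blast
      obtain Gs2 where 2: "globally_rigid_gluing_construction TYPE('d) (induced X2) Gs2"
        using psubset.IH[OF *(3) V(2) *(6) card(2)] by blast
      have "globally_rigid_gluing_construction TYPE('d) (induced X) (Gs1 @ Gs2 @ [induced X])"
        by (rule gluing_construction_union[OF 1 2 pair_graph_induced[OF psubset.prems(1)] _ induced_separation[OF *(1)]])
           (use * psubset.prems(3) in auto)
      then show ?thesis by blast
    qed
  qed
qed

lemma well_linked_congruent:
  fixes p q :: "'a \<Rightarrow> real ^ 'd"
  assumes "X \<subseteq> pverts G" "well_linked (DIM(real ^ 'd) + 1) X"
    and gp: "general_position X p" and eq: "equivalent_realizations (induced X) p q"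
  shows "congruent_on X p q"
proof -
  have "finite X" using assms pair_finite_verts finite_subset by blast
  then show ?thesis using assms
  proof (induction X rule: finite_psubset_induct)
    case (psubset X)
    show ?case
    proof (cases "clique X")
      case True
      then show ?thesis using clique_congruent psubset.prems by blast
    next
      case False
      obtain X1 X2 where *: "separation X X1 X2" "X1 \<subset> X" "X2 \<subset> X" "DIM(real ^ 'd) + 1 \<le> card (X1 \<inter> X2)"
        "well_linked (DIM(real ^ 'd) + 1) X1" "well_linked (DIM(real ^ 'd) + 1) X2"
        using well_linked_split[OF psubset.prems(1,2) False] by metis
      have X: "X = X1 \<union> X2" using * by (simp add: separation_def)
      have c: "congruent_on Y p q" if "Y \<subset> X" "well_linked (DIM(real ^ 'd) + 1) Y" for Y
      proof (rule psubset.IH[OF that(1) _ that(2)])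
        show "Y \<subseteq> pverts G" using that psubset.prems(1) by auto
        show "general_position Y p" using general_position_subset[OF psubset.prems(3)] that by auto
        show "equivalent_realizations (induced Y) p q"
          using equivalent_realizations_subset[OF psubset.prems(4)] that by auto
      qed
      show ?thesis
        using glue_congruent[OF psubset.prems(3)[unfolded X] c[OF *(2,5)] c[OF *(3,6)] *(4)]
        unfolding X .
    qed
  qed
qed

text \<open>With sequences no radius has to be computed: each gluing is valid from some index on,
  and finitely many such statements combine.\<close>

lemma well_linked_eventually_congruent:
  fixes p :: "'a \<Rightarrow> real ^ 'd" and q :: "nat \<Rightarrow> 'a \<Rightarrow> real ^ 'd"
  assumes "X \<subseteq> pverts G" "well_linked DIM(real ^ 'd) X"
    and "general_position X p" and "\<And>n. equivalent_realizations (induced X) p (q n)"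
    and "\<And>x. x \<in> X \<Longrightarrow> (\<lambda>n. q n x) \<longlonglongrightarrow> p x"
  shows "\<forall>\<^sub>F n in sequentially. congruent_on X p (q n)"
proof -
  have "finite X" using assms pair_finite_verts finite_subset by blast
  then show ?thesis using assms
  proof (induction X rule: finite_psubset_induct)
    case (psubset X)
    show ?case
    proof (cases "clique X")
      case True
      then show ?thesis using clique_congruent psubset.prems by (intro always_eventually) blast
    next
      case False
      obtain X1 X2 where *: "separation X X1 X2" "X1 \<subset> X" "X2 \<subset> X" "DIM(real ^ 'd) \<le> card (X1 \<inter> X2)"
        "well_linked DIM(real ^ 'd) X1" "well_linked DIM(real ^ 'd) X2"
        using well_linked_split[OF psubset.prems(1,2) False] by metis
      have X: "X = X1 \<union> X2" using * by (simp add: separation_def)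
      have c: "\<forall>\<^sub>F n in sequentially. congruent_on Y p (q n)" if "Y \<subset> X" "well_linked DIM(real ^ 'd) Y" for Y
      proof (rule psubset.IH[OF that(1) _ that(2)])
        show "Y \<subseteq> pverts G" using that psubset.prems(1) by auto
        show "general_position Y p" using general_position_subset[OF psubset.prems(3)] that by auto
        show "equivalent_realizations (induced Y) p (q n)" for n
          using equivalent_realizations_subset[OF psubset.prems(4)] that by auto
        show "(\<lambda>n. q n x) \<longlonglongrightarrow> p x" if "x \<in> Y" for x
          using psubset.prems(5) that \<open>Y \<subset> X\<close> by auto
      qed
      have fin: "finite X1" "finite X2" using * psubset.hyps by (auto intro: finite_subset)
      have ne: "X1 \<union> X2 \<noteq> X1 \<inter> X2" using * X by auto
      show ?thesis
        using glue_eventually_congruent[OF psubset.prems(3)[unfolded X] fin *(4) ne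
            psubset.prems(5)[unfolded X] c[OF *(2,5)] c[OF *(3,6)]]
        unfolding X .
    qed
  qed
qed

text \<open>The hypothesis concerns the single pair \<open>x\<close>, \<open>y\<close>, so that it
  descends to the part containing both at each splitting. \<open>X\<close> as a whole has to be well
  linked only when the recursion stops.\<close>

lemma inseparable_norm_eq:
  fixes p q :: "'a \<Rightarrow> real ^ 'd"
  assumes "X \<subseteq> pverts G" "x \<in> X" "y \<in> X"
    and "\<And>T. finite T \<Longrightarrow> card T < DIM(real ^ 'd) + 1 \<Longrightarrow> x \<notin> T \<Longrightarrow> y \<notin> T \<Longrightarrow> reach (X - T) x y"
    and "general_position X p" "equivalent_realizations (induced X) p q"
  shows "norm (p x - p y) = norm (q x - q y)"
proof -
  have "finite X" using assms pair_finite_verts finite_subset by blast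
  then show ?thesis using assms
  proof (induction X rule: finite_psubset_induct)
    case (psubset X)
    note xy = psubset.prems(2,3)
    show ?case
    proof (cases "well_linked (DIM(real ^ 'd) + 1) X")
      case True
      then show ?thesis
        using well_linked_congruent[OF psubset.prems(1) _ psubset.prems(5,6)] xy
        by (simp add: congruent_on_def)
    next
      case False
      then obtain T a b where T: "finite T" "card T < DIM(real ^ 'd) + 1" "a \<in> X - T" "b \<in> X - T"
        "\<not> reach (X - T) a b"
        unfolding well_linked_def by metis
      obtain X1 X2 where *: "separation X X1 X2" "X1 \<inter> X2 \<subseteq> T" "a \<in> X1 - X2" "b \<in> X2 - X1"
        using clique_separation[OF psubset.prems(1) T(3-5)] by metis
      have X: "X = X1 \<union> X2" using * by (simp add: separation_def)
      have "finite (X1 \<inter> X2)" "card (X1 \<inter> X2) < DIM(real ^ 'd) + 1"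
        using T * card_mono[of T "X1 \<inter> X2"] finite_subset by auto
      then have sep: "x \<in> X1 \<inter> X2 \<or> y \<in> X1 \<inter> X2 \<or> reach (X - X1 \<inter> X2) x y"
        using psubset.prems(4) by metis
      have side: "norm (p x - p y) = norm (q x - q y)"
        if Y: "separation X Y Z" "c \<in> Z - Y" "x \<in> Y" "y \<in> Y" for Y Z c
      proof (rule psubset.IH[OF _ _ Y(3,4)])
        show YX: "Y \<subset> X" using Y by (auto simp: separation_def)
        then show "Y \<subseteq> pverts G" using psubset.prems(1) by auto
        show "reach (Y - T) x y" if "finite T" "card T < DIM(real ^ 'd) + 1" "x \<notin> T" "y \<notin> T" for T
          using separation_reach[OF Y(1) _ _ psubset.prems(4)[OF that]] Y that by simp
        show "general_position Y p" using general_position_subset[OF psubset.prems(5)] YX by auto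
        show "equivalent_realizations (induced Y) p q"
          using equivalent_realizations_subset[OF psubset.prems(6)] YX by auto
      qed
      have "\<not> (x \<in> X1 - X2 \<and> y \<in> X2 - X1)"
        using sep separation_separates[OF *(1), of x y] by auto
      moreover have "\<not> (x \<in> X2 - X1 \<and> y \<in> X1 - X2)"
        using sep separation_separates[OF separation_sym[OF *(1)], of x y] by (auto simp: Int_commute)
      ultimately have "(x \<in> X1 \<and> y \<in> X1) \<or> (x \<in> X2 \<and> y \<in> X2)" using xy X by auto
      then show ?thesis
        using side[OF *(1,4)] side[OF separation_sym[OF *(1)] *(3)] by auto
    qed
  qed
qed

section \<open>Local connectivity and separators\<close>

lemma vwalk_reach:
  "p \<noteq> [] \<Longrightarrow> set (vwalk_arcs p) \<subseteq> parcs G \<Longrightarrow> set p \<subseteq> Y \<Longrightarrow> reach Y (hd p) (last p)"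
proof (induction p rule: vwalk_arcs.induct)
  case (3 u v p)
  then have "(u, v) \<in> parcs G \<inter> Y \<times> Y" "reach Y v (last (v # p))" by auto
  then have "reach Y u (last (v # p))" by (rule converse_rtrancl_into_rtrancl)
  then show ?case by simp
qed auto

lemma finite_paths_between: "finite (paths_between G x y)"
proof (rule finite_subset)
  show "paths_between G x y \<subseteq> {p. set p \<subseteq> pverts G \<and> length p \<le> card (pverts G)}"
  proof
    fix p assume "p \<in> paths_between G x y"
    then have p: "set p \<subseteq> pverts G" "distinct p"
      by (auto simp: paths_between_def vpath_def vwalk_def)
    then have "length p \<le> card (pverts G)"
      using card_mono[OF pair_finite_verts p(1)] distinct_card[OF p(2)] by simp
    then show "p \<in> {p. set p \<subseteq> pverts G \<and> length p \<le> card (pverts G)}" using p by simp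
  qed
  show "finite {p. set p \<subseteq> pverts G \<and> length p \<le> card (pverts G)}"
    using pair_finite_verts by (rule finite_lists_length_le)
qed

lemma local_connectivity_ge_iff:
  "k \<le> local_connectivity G x y \<longleftrightarrow>
     (\<exists>P \<subseteq> paths_between G x y. pairwise (\<lambda>p q. set p \<inter> set q = {x, y}) P \<and> k \<le> card P)"
proof -
  let ?K = "{card P | P. P \<subseteq> paths_between G x y \<and> pairwise (\<lambda>p q. set p \<inter> set q = {x, y}) P}"
  have "?K \<subseteq> card ` Pow (paths_between G x y)" by auto
  then have fin: "finite ?K" using finite_paths_between finite_subset by blast
  \<comment> \<open>The empty family keeps the set of cardinalities non-empty, so that its
    \<open>Max\<close> is meaningful.\<close>
  have "card {} \<in> ?K" by (intro CollectI exI[of _ "{}"]) simp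
  then have ne: "?K \<noteq> {}" by blast
  show ?thesis
    unfolding local_connectivity_def Max_ge_iff[OF fin ne] by auto
qed

text \<open>Pigeonhole: a vertex other than \<open>x\<close> and \<open>y\<close> lies on at most
  one of the paths, so fewer than \<open>k\<close> such vertices cannot meet them all.\<close>

lemma local_connectivity_reach:
  assumes "k \<le> local_connectivity G x y" "finite T" "card T < k" "x \<notin> T" "y \<notin> T"
  shows "reach (pverts G - T) x y"
proof -
  obtain P where P: "P \<subseteq> paths_between G x y" "pairwise (\<lambda>p q. set p \<inter> set q = {x, y}) P" "k \<le> card P"
    using assms(1) local_connectivity_ge_iff by metis
  have "\<exists>p\<in>P. set p \<inter> T = {}"
  proof (rule ccontr)
    assume "\<not> ?thesis"
    then have "\<forall>p\<in>P. \<exists>t. t \<in> set p \<inter> T" by auto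
    then obtain f where f: "\<And>p. p \<in> P \<Longrightarrow> f p \<in> set p \<inter> T" by metis
    have "inj_on f P"
    proof (rule inj_onI, rule ccontr)
      fix p q assume *: "p \<in> P" "q \<in> P" "f p = f q" "p \<noteq> q"
      then have "f p \<in> set p \<inter> set q" using f[of p] f[of q] by auto
      then have "f p \<in> {x, y}" using P(2) * by (auto simp: pairwise_def)
      then show False using f[OF *(1)] assms(4,5) by auto
    qed
    then have "card P \<le> card T" using f assms(2) by (intro card_inj_on_le) auto
    then show False using P(3) assms(3) by simp
  qed
  then obtain p where p: "p \<in> P" "set p \<inter> T = {}" by blast
  then have "vpath p (with_proj G)" "hd p = x" "last p = y" using P(1) by (auto simp: paths_between_def)
  then have "p \<noteq> []" "set (vwalk_arcs p) \<subseteq> parcs G" "set p \<subseteq> pverts G - T"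
    using p by (auto simp: vpath_def vwalk_def)
  then show ?thesis using vwalk_reach \<open>hd p = x\<close> \<open>last p = y\<close> by metis
qed

text \<open>Two conventions are bridged: \<open>connected\<close> means strong connectivity of the
  symmetric closure, which adds no arcs here, and \<open>vertex_connected\<close> deletes only
  vertices of the graph, so \<open>T\<close> is intersected with them.\<close>

lemma vertex_connected_well_linked:
  assumes "vertex_connected k G"
  shows "well_linked k (pverts G)"
  unfolding well_linked_def
proof (intro allI impI ballI)
  fix T a b assume T: "finite T \<and> card T < k" and ab: "a \<in> pverts G - T" "b \<in> pverts G - T"
  define S where "S = T \<inter> pverts G"
  have "card S < k" using T card_mono[of T S] by (auto simp: S_def)
  then have "Digraph_Component.connected (with_proj G \<restriction> (pverts G - S))"
    using assms unfolding vertex_connected_def S_def by blast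
  moreover have eq: "pverts G - S = pverts G - T" by (auto simp: S_def)
  moreover have "parcs (mk_symmetric (with_proj G \<restriction> (pverts G - T))) \<subseteq> parcs G \<inter> (pverts G - T) \<times> (pverts G - T)"
    using adj_sym by (auto simp: mk_symmetric_def)
  moreover have "pverts (mk_symmetric (with_proj G \<restriction> (pverts G - T))) = pverts G - T"
    by (simp add: mk_symmetric_def)
  ultimately have "(a, b) \<in> (parcs (mk_symmetric (with_proj G \<restriction> (pverts G - T))))\<^sup>*"
    using ab reachable_rtranclI[of "with_proj (mk_symmetric (with_proj G \<restriction> (pverts G - T)))" a b]
    unfolding Digraph_Component.connected_def strongly_connected_def by simp
  then show "reach (pverts G - T) a b"
    using rtrancl_mono \<open>_ \<subseteq> parcs G \<inter> (pverts G - T) \<times> (pverts G - T)\<close> by blast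
qed

text \<open>Reflecting the component of \<open>x\<close> in the hyperplane through the separator keeps all edge
  lengths but moves \<open>x\<close> relative to \<open>y\<close>.\<close>

lemma separated_not_linked:
  fixes p :: "'a \<Rightarrow> real ^ 'd"
  assumes gp: "general_position (pverts G) p" and S: "S \<subseteq> pverts G" "card S = DIM(real ^ 'd)"
    and xy: "x \<in> pverts G - S" "y \<in> pverts G - S" "\<not> reach (pverts G - S) x y"
  shows "\<exists>q. equivalent_realizations G p q \<and> norm (p x - p y) \<noteq> norm (q x - q y)"
proof -
  have finS: "finite S" using S pair_finite_verts finite_subset by blast
  have "S \<noteq> {}" using S(2) by auto
  then obtain s0 where s0: "s0 \<in> S" by auto
  obtain a where a: "a \<noteq> 0" "\<And>s. s \<in> S \<Longrightarrow> a \<bullet> (p s - p s0) = 0"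
    "\<And>x. x \<in> pverts G - S \<Longrightarrow> a \<bullet> (p x - p s0) \<noteq> 0"
    using separating_normal_exists[OF gp S(1) finS S(2) s0] by metis
  define r where "r z = z - (2 * (a \<bullet> (z - p s0)) / (a \<bullet> a)) *\<^sub>R a" for z
  note refl = reflection_preserves_norm[OF a(1), where s = "p s0", folded r_def]
  define C where "C = {w. reach (pverts G - S) x w}"
  define q where "q w = (if w \<in> C then r (p w) else p w)" for w
  have fixS: "r (p s) = p s" if "s \<in> S" for s using a(2)[OF that] by (simp add: r_def)
  have CV: "C \<subseteq> pverts G - S" using reach_in xy by (auto simp: C_def)
  have out: "w \<in> S" if "(u, w) \<in> parcs G" "u \<in> C" "w \<notin> C" for u w
  proof (rule ccontr)
    assume "w \<notin> S"
    then have "(u, w) \<in> parcs G \<inter> (pverts G - S) \<times> (pverts G - S)"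
      using that CV in_arcsD2 by auto
    then have "reach (pverts G - S) x w"
      using that(2) unfolding C_def by (auto intro: rtrancl_into_rtrancl)
    then show False using that(3) by (simp add: C_def)
  qed
  have edge: "norm (p u - p w) = norm (q u - q w)" if "(u, w) \<in> parcs G" for u w
  proof -
    \<comment> \<open>An edge that meets \<open>C\<close> has its other end in \<open>C\<close> or
      in \<open>S\<close>, and \<open>r\<close> fixes the points of \<open>S\<close>; so both ends
      may be regarded as reflected.\<close>
    have "q u - q w = r (p u) - r (p w)" if "u \<in> C \<or> w \<in> C"
    proof -
      have "u \<in> C \<or> u \<in> S" "w \<in> C \<or> w \<in> S"
        using out[of u w] out[of w u] \<open>(u, w) \<in> parcs G\<close> adj_sym that by blast+
      then show ?thesis using fixS CV by (auto simp: q_def)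
    qed
    then show ?thesis using refl(1) by (cases "u \<in> C \<or> w \<in> C") (auto simp: q_def)
  qed
  have "x \<in> C" "y \<notin> C" using xy(3) by (auto simp: C_def)
  then have "(norm (q x - q y))\<^sup>2 = (norm (p x - p y))\<^sup>2 +
      4 * (a \<bullet> (p x - p s0)) * (a \<bullet> (p y - p s0)) / (a \<bullet> a)"
    using refl(2) by (simp add: q_def)
  moreover have "4 * (a \<bullet> (p x - p s0)) * (a \<bullet> (p y - p s0)) / (a \<bullet> a) \<noteq> 0"
    using a xy by simp
  ultimately have "norm (p x - p y) \<noteq> norm (q x - q y)" by auto
  moreover have "equivalent_realizations G p q"
    using edge by (auto simp: equivalent_realizations_def)
  ultimately show ?thesis by blast
qed

lemma well_linked_rigid:
  assumes "well_linked CARD('d::finite) (pverts G)"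
  shows "rigid TYPE('d) G"
  unfolding rigid_def
proof (intro allI impI, rule ccontr)
  fix p :: "'a \<Rightarrow> real ^ 'd"
  assume p: "generic_realization G p"
    and not: "\<not> (\<exists>\<epsilon>>0. \<forall>q. equivalent_realizations G p q \<and> (\<forall>x\<in>pverts G. norm (p x - q x) < \<epsilon>) \<longrightarrow>
       congruent_realizations G p q)"
  have "\<exists>q. equivalent_realizations G p q \<and> (\<forall>x\<in>pverts G. norm (p x - q x) < \<epsilon>) \<and>
       \<not> congruent_realizations G p q" if "\<epsilon> > 0" for \<epsilon>
    using not that by blast
  \<comment> \<open>Counterexamples within \<open>1 / (n + 1)\<close> form a sequence converging to
    \<open>p\<close>, to which eventual congruence applies.\<close>
  then have "\<forall>n. \<exists>q. equivalent_realizations G p q \<and>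
      (\<forall>x\<in>pverts G. norm (p x - q x) < inverse (real (Suc n))) \<and> \<not> congruent_realizations G p q"
    by simp
  then obtain q where q: "\<And>n. equivalent_realizations G p (q n)"
    "\<And>n x. x \<in> pverts G \<Longrightarrow> norm (p x - q n x) < inverse (real (Suc n))"
    "\<And>n. \<not> congruent_realizations G p (q n)"
    by metis
  have "(\<lambda>n. q n x) \<longlonglongrightarrow> p x" if "x \<in> pverts G" for x
  proof (rule metric_tendsto_imp_tendsto[OF LIMSEQ_inverse_real_of_nat])
    show "\<forall>\<^sub>F n in sequentially. dist (q n x) (p x) \<le> dist (inverse (real (Suc n))) 0"
      using q(2)[OF that] by (intro always_eventually) (auto simp: dist_norm norm_minus_commute less_imp_le)
  qed
  moreover have "general_position (pverts G) p"
    using p by (rule generic_realization_general_position)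
  moreover have "well_linked DIM(real ^ 'd) (pverts G)" using assms by simp
  ultimately have "\<forall>\<^sub>F n in sequentially. congruent_on (pverts G) p (q n)"
    using q(1) by (intro well_linked_eventually_congruent) (simp_all add: induced_pverts)
  then obtain n where "congruent_on (pverts G) p (q n)"
    by (auto simp: eventually_sequentially)
  then show False
    using q(3)[of n] by (simp add: congruent_on_def congruent_realizations_def)
qed

lemma globally_linked_iff:
  assumes d: "well_linked CARD('d::finite) (pverts G)"
    and xy: "x \<in> pverts G" "y \<in> pverts G" "x \<noteq> y"
  shows "globally_linked TYPE('d) G x y \<longleftrightarrow>
     (x, y) \<in> parcs G \<or> local_connectivity G x y \<ge> CARD('d) + 1"
proof
  assume linked: "globally_linked TYPE('d) G x y"
  show "(x, y) \<in> parcs G \<or> local_connectivity G x y \<ge> CARD('d) + 1"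
  proof (rule ccontr)
    assume not: "\<not> ?thesis"
    then have "\<not> (\<exists>P. finite P \<and> card P = CARD('d) + 1 \<and> P \<subseteq> paths_between G x y \<and>
        pairwise (\<lambda>p q. set p \<inter> set q = {x, y}) P)"
      unfolding local_connectivity_ge_iff by (metis order_refl)
    then obtain T where T: "finite T" "card T < CARD('d) + 1" "x \<notin> T" "y \<notin> T"
      "\<not> reach (pverts G - T) x y"
      using chordal_menger[OF order_refl xy, of "CARD('d) + 1"] not by metis
    define S where "S = T \<inter> pverts G"
    have S: "finite S" "S \<subseteq> pverts G" "card S \<le> card T" "x \<in> pverts G - S" "y \<in> pverts G - S"
      using T xy by (auto simp: S_def intro: card_mono)
    have "pverts G - S = pverts G - T" by (auto simp: S_def)
    then have n: "\<not> reach (pverts G - S) x y" using T by simp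
    \<comment> \<open>\<open>S\<close> has at most \<open>CARD('d)\<close> elements and
      \<open>well_linked\<close> forbids fewer. Exactly this many points in general position
      determine the mirror.\<close>
    then have "\<not> card S < CARD('d)"
      using d S unfolding well_linked_def by metis
    then have card: "card S = DIM(real ^ 'd)" using S T by simp
    obtain p :: "'a \<Rightarrow> real ^ 'd" where p: "generic_realization G p"
      using generic_realization_exists[OF pair_finite_verts] by blast
    obtain q where "equivalent_realizations G p q" "norm (p x - p y) \<noteq> norm (q x - q y)"
      using separated_not_linked[OF generic_realization_general_position[OF p] S(2) card S(4,5) n] by blast
    then show False using linked p unfolding globally_linked_def by blast
  qed
next
  assume *: "(x, y) \<in> parcs G \<or> local_connectivity G x y \<ge> CARD('d) + 1"
  show "globally_linked TYPE('d) G x y"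
    unfolding globally_linked_def
  proof (intro allI impI)
    fix p q :: "'a \<Rightarrow> real ^ 'd"
    assume p: "generic_realization G p" and q: "equivalent_realizations G p q"
    show "norm (p x - p y) = norm (q x - q y)"
    proof (cases "(x, y) \<in> parcs G")
      case True
      then show ?thesis using q by (auto simp: equivalent_realizations_def)
    next
      case False
      then have "CARD('d) + 1 \<le> local_connectivity G x y" using * by simp
      then have "reach (pverts G - T) x y"
        if "finite T" "card T < DIM(real ^ 'd) + 1" "x \<notin> T" "y \<notin> T" for T
        using local_connectivity_reach that by simp
      then show ?thesis
        using inseparable_norm_eq[OF order_refl xy(1,2) _ generic_realization_general_position[OF p], of q] q
        by (simp add: induced_pverts)
    qed
  qed
qed

end

theorem theorem4p12:
  fixes G :: "'a pair_pre_digraph"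
  assumes "pair_graph G"
    and "vertex_connected CARD('d::finite) G"
    and "chordal G"
  shows "(\<exists>Gs. globally_rigid_gluing_construction TYPE('d) G Gs) \<and> joined TYPE('d) G"
proof -
  interpret chordal_graph G
    using assms by (simp add: chordal_graph_def chordal_graph_axioms_def)
  have d: "well_linked CARD('d) (pverts G)" "CARD('d) + 1 \<le> card (pverts G)"
    using vertex_connected_well_linked assms(2) by (auto simp: vertex_connected_def)
  have "\<exists>Gs. globally_rigid_gluing_construction TYPE('d) G Gs"
    using gluing_construction_exists[OF order_refl d] by (simp add: induced_pverts)
  moreover have "joined TYPE('d) G"
    unfolding joined_def using d well_linked_rigid[OF d(1)] globally_linked_iff[OF d(1)] by simp
  ultimately show ?thesis by blast
qed

end
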